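(* Let $m\ge 2$ be a fixed integer, let $p,q\in(0,1)$ be fixed constants with $p>q$, let $t>0$ be a constant, and let $\alpha=\alpha_n=\frac{t\log n}{n^{m-1}}$. Define $$I_m(p,q)=\frac{2^{m-1}(m-1)!}{(\sqrt{p}-\sqrt{q})^{2}+(\sqrt{1-p}-\sqrt{1-q})^{2}}.$$ Let $\sigma\in\{\pm1\}^n$ be the true label vector and $A$ the observed censored hypergraph of the model $\mathcal{H}_m(n,p,q,\alpha)$. If $t<I_m(p,q)$, then for any estimator $\hat\sigma=\hat\sigma(A)$ of $\sigma$, $$\mathbb{P}(\hat\sigma=\sigma)=o(1)\qquad (n\to\infty).$$
   Context: Censored $m$-uniform hypergraph stochastic block model $\mathcal{H}_m(n,p,q,\alpha)$: the node set is $\{1,\dots,n\}$. Each node $i$ independently receives a label $\sigma_i$ with $\mathbb{P}(\sigma_i=+1)=\mathbb{P}(\sigma_i=-1)=\tfrac12$; $\sigma=(\sigma_1,\dots,\sigma_n)$ is the true label vector, and $I_+(\sigma)=\{i:\sigma_i=+1\}$, $I_-(\sigma)=\{i:\sigma_i=-1\}$ are the two communities. Given $\sigma$, independently over all $m$-element subsets $\{i_1,\dots,i_m\}$ of nodes, the subset is a hyperedge with probability $p$ if it is contained in $I_+(\sigma)$ or in $I_-(\sigma)$, and with probability $q$ otherwise. Independently for each $m$-subset, its status is revealed with probability $\alpha$. The observation $A$ assigns to each $m$-subset a value $A_{i_1\cdots i_m}\in\{1,0,*\}$ (symmetric in the indices): $1$ if revealed and present, $0$ if revealed and absent, $*$ if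 not revealed (censored). The value $\alpha_n=\frac{t\log n}{n^{m-1}}$ is at most $1$ for all large $n$. An estimator is a (sequence in $n$ of) function(s) of $A$ with values in $\{\pm1\}^n$. *)

theory Defs
  imports "HOL-Probability.Probability" "HOL-Library.Ramsey" "HOL-Library.Monad_Syntax"
begin

text \<open>
  Functions on a finite index set (nodes \<open>{1..n}\<close>, or \<open>m\<close>-subsets of nodes) are total functions
  with a fixed default value off the index set, so that label vectors and observations can be
  compared by plain equality. The default label \<open>0\<close> is not a community label.
\<close>

definition labelings :: "nat \<Rightarrow> (nat \<Rightarrow> int) set" where
  "labelings n = PiE_dflt {1..n} 0 (\<lambda>_. {1, -1})"

definition I_plus :: "nat \<Rightarrow> (nat \<Rightarrow> int) \<Rightarrow> nat set" where
  "I_plus n \<sigma> = {i \<in> {1..n}. \<sigma> i = 1}"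

definition I_minus :: "nat \<Rightarrow> (nat \<Rightarrow> int) \<Rightarrow> nat set" where
  "I_minus n \<sigma> = {i \<in> {1..n}. \<sigma> i = -1}"

text \<open>
  An observation maps an \<open>m\<close>-subset to \<open>Some True\<close> (the value 1: revealed and present),
  \<open>Some False\<close> (the value 0: revealed and absent) or \<open>None\<close> (the value *: censored).
\<close>

type_synonym observation = "nat set \<Rightarrow> bool option"

definition observations :: "nat \<Rightarrow> nat \<Rightarrow> observation set" where
  "observations m n = PiE_dflt (nsets {1..n} m) None (\<lambda>_. UNIV)"

definition prior :: "nat \<Rightarrow> (nat \<Rightarrow> int) pmf" where
  "prior n = Pi_pmf {1..n} 0 (\<lambda>_. pmf_of_set {1, -1})"

definition edge_prob :: "nat \<Rightarrow> real \<Rightarrow> real \<Rightarrow> (nat \<Rightarrow> int) \<Rightarrow> nat set \<Rightarrow> real" where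
  "edge_prob n p q \<sigma> e = (if e \<subseteq> I_plus n \<sigma> \<or> e \<subseteq> I_minus n \<sigma> then p else q)"

text \<open>
  The joint law of \<open>(\<sigma>, A)\<close>; \<open>H\<close> is the full hypergraph and \<open>R\<close> the set of revealed
  \<open>m\<close>-subsets, both as indicator functions. \<^const>\<open>bernoulli_pmf\<close> clamps its parameter to
  \<open>[0, 1]\<close>, so the law is defined (with everything revealed) even when \<open>\<alpha> > 1\<close>.
\<close>

definition censored_hsbm ::
  "nat \<Rightarrow> nat \<Rightarrow> real \<Rightarrow> real \<Rightarrow> real \<Rightarrow> ((nat \<Rightarrow> int) \<times> observation) pmf" where
  "censored_hsbm m n p q \<alpha> =
     do {
       \<sigma> \<leftarrow> prior n;
       H \<leftarrow> Pi_pmf (nsets {1..n} m) False (\<lambda>e. bernoulli_pmf (edge_prob n p q \<sigma> e));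
       R \<leftarrow> Pi_pmf (nsets {1..n} m) False (\<lambda>_. bernoulli_pmf \<alpha>);
       return_pmf (\<sigma>, \<lambda>e. if R e then Some (H e) else None)
     }"

definition recovery_threshold :: "nat \<Rightarrow> real \<Rightarrow> real \<Rightarrow> real" where
  "recovery_threshold m p q =
     2 ^ (m - 1) * fact (m - 1) /
       ((sqrt p - sqrt q)\<^sup>2 + (sqrt (1 - p) - sqrt (1 - q))\<^sup>2)"

end

theory Submission
  imports Defs "HOL-Real_Asymp.Real_Asymp"
begin

text \<open>
  If, with high probability, at least \<open>K\<close> labelings are no less likely than the true one, then no
  estimator succeeds with probability more than \<open>1 / K + o(1)\<close>, because the prior is uniform. Such
  labelings are found among the flips of a single node of \<open>S = {1..s}\<close>, where \<open>s\<close> is about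
  \<open>n powr (1 - \<epsilon>)\<close>. The likelihood change caused by flipping \<open>i \<in> S\<close> and coming from the edges
  \<open>e\<close> with \<open>e \<inter> S = {i}\<close> is independent for different \<open>i\<close>, and the other edges through \<open>i\<close> that
  meet \<open>S\<close> are all censored with probability \<open>1 - o(1)\<close>, since \<open>s\<close> is much smaller than \<open>n / ln n\<close>.

  For balanced communities, tilting the log-likelihood ratio at exponent \<open>1/2\<close> makes it symmetric
  with variance \<open>O(ln n)\<close>, so a flip does not decrease the likelihood with probability at least
  \<open>n powr (- t / I - O(\<epsilon>))\<close>, \<open>I\<close> being the threshold. As \<open>t / I < 1\<close>, the expected number of such flips in \<open>S\<close> tends to
  infinity, and by Chebyshev's inequality so does the number itself, in probability.
\<close>

section \<open>Product distributions with finite support\<close>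

lemma expectation_pair_pmf_mult:
  fixes f :: "'a \<Rightarrow> real" and g :: "'b \<Rightarrow> real"
  assumes "finite (set_pmf M)" "finite (set_pmf N)"
  shows "measure_pmf.expectation (pair_pmf M N) (\<lambda>(a, b). f a * g b) =
           measure_pmf.expectation M f * measure_pmf.expectation N g"
proof -
  have "measure_pmf.expectation (pair_pmf M N) (\<lambda>(a, b). f a * g b) =
          (\<Sum>(a, b)\<in>set_pmf M \<times> set_pmf N. (f a * g b) * (pmf M a * pmf N b))"
    using assms by (subst integral_measure_pmf_real[where A = "set_pmf M \<times> set_pmf N"])
      (auto simp: pmf_pair intro!: sum.cong)
  also have "\<dots> = (\<Sum>a\<in>set_pmf M. f a * pmf M a) * (\<Sum>b\<in>set_pmf N. g b * pmf N b)"
    by (simp add: sum_product sum.cartesian_product mult_ac)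
  also have "\<dots> = measure_pmf.expectation M f * measure_pmf.expectation N g"
    using assms by (subst (1 2) integral_measure_pmf_real) auto
  finally show ?thesis .
qed

lemma finite_set_Pi_pmf:
  assumes "finite I" "\<And>i. i \<in> I \<Longrightarrow> finite (set_pmf (p i))"
  shows "finite (set_pmf (Pi_pmf I d p))"
  using assms by (auto simp: set_Pi_pmf)

text \<open>The marginal on \<open>J\<close> is the image of the whole product under restriction to
  \<open>J\<close>, which \<open>f\<close> cannot detect. Dependence on \<open>J\<close> alone is
  expressed by comparing two arguments that agree on \<open>J\<close>; the independence lemmas below
  use the same form.\<close>

lemma expectation_Pi_pmf_subset:
  fixes f :: "('i \<Rightarrow> 'b) \<Rightarrow> real"
  assumes "finite I" "J \<subseteq> I"
    and "\<And>x y. (\<And>i. i \<in> J \<Longrightarrow> x i = y i) \<Longrightarrow> f x = f y"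
  shows "measure_pmf.expectation (Pi_pmf I d p) f = measure_pmf.expectation (Pi_pmf J d p) f"
proof -
  have "f (\<lambda>x. if x \<in> J then y x else d) = f y" for y by (rule assms(3)) auto
  then show ?thesis by (simp add: Pi_pmf_subset[OF assms(1,2)])
qed

lemma prob_Pi_pmf_subset:
  assumes "finite I" "J \<subseteq> I"
    and "\<And>x y. (\<And>i. i \<in> J \<Longrightarrow> x i = y i) \<Longrightarrow> x \<in> S \<longleftrightarrow> y \<in> S"
  shows "measure_pmf.prob (Pi_pmf I d p) S = measure_pmf.prob (Pi_pmf J d p) S"
proof -
  have "indicator S x = (indicator S y :: real)" if "\<And>i. i \<in> J \<Longrightarrow> x i = y i" for x y
    using assms(3)[OF that] by (simp add: indicator_def)
  then have "measure_pmf.expectation (Pi_pmf I d p) (indicator S) =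
             (measure_pmf.expectation (Pi_pmf J d p) (indicator S) :: real)"
    by (rule expectation_Pi_pmf_subset[OF assms(1,2)])
  then show ?thesis by simp
qed

text \<open>Disjoint blocks of coordinates are independent: the product over
  \<open>J \<union> K\<close> is the image of a pair of block laws under gluing, and
  \<open>f\<close> and \<open>g\<close> each read one half of the glued function.\<close>

lemma expectation_mult_Pi_pmf:
  fixes f g :: "('i \<Rightarrow> 'b) \<Rightarrow> real"
  assumes fin: "finite I" "\<And>i. i \<in> I \<Longrightarrow> finite (set_pmf (p i))"
    and sub: "J \<subseteq> I" "K \<subseteq> I" "J \<inter> K = {}"
    and f: "\<And>x y. (\<And>i. i \<in> J \<Longrightarrow> x i = y i) \<Longrightarrow> f x = f y"
    and g: "\<And>x y. (\<And>i. i \<in> K \<Longrightarrow> x i = y i) \<Longrightarrow> g x = g y"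
  shows "measure_pmf.expectation (Pi_pmf I d p) (\<lambda>x. f x * g x) =
           measure_pmf.expectation (Pi_pmf I d p) f * measure_pmf.expectation (Pi_pmf I d p) g"
proof -
  have fin': "finite J" "finite K" using fin sub finite_subset by blast+
  have "measure_pmf.expectation (Pi_pmf I d p) (\<lambda>x. f x * g x) =
        measure_pmf.expectation (Pi_pmf (J \<union> K) d p) (\<lambda>x. f x * g x)"
    using sub by (intro expectation_Pi_pmf_subset arg_cong2[where f = times] f g fin) auto
  also have "\<dots> = measure_pmf.expectation (pair_pmf (Pi_pmf J d p) (Pi_pmf K d p))
                   (\<lambda>z. case z of (x, y) \<Rightarrow> f (\<lambda>i. if i \<in> J then x i else y i) *
                                 g (\<lambda>i. if i \<in> J then x i else y i))"
    by (subst Pi_pmf_union[OF fin' sub(3)]) (simp add: case_prod_unfold)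
  also have "\<dots> = measure_pmf.expectation (pair_pmf (Pi_pmf J d p) (Pi_pmf K d p))
                   (\<lambda>(x, y). f x * g y)"
  proof (intro Bochner_Integration.integral_cong refl, clarify)
    fix x y :: "'i \<Rightarrow> 'b"
    have "f (\<lambda>i. if i \<in> J then x i else y i) = f x" by (rule f) simp
    moreover have "g (\<lambda>i. if i \<in> J then x i else y i) = g y" using sub(3) by (intro g) auto
    ultimately show "f (\<lambda>i. if i \<in> J then x i else y i) * g (\<lambda>i. if i \<in> J then x i else y i) =
      f x * g y" by simp
  qed
  also have "\<dots> = measure_pmf.expectation (Pi_pmf J d p) f * measure_pmf.expectation (Pi_pmf K d p) g"
    using fin fin' sub by (intro expectation_pair_pmf_mult finite_set_Pi_pmf) auto
  also have "measure_pmf.expectation (Pi_pmf J d p) f = measure_pmf.expectation (Pi_pmf I d p) f"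
    by (rule expectation_Pi_pmf_subset[OF fin(1) sub(1) f, symmetric])
  also have "measure_pmf.expectation (Pi_pmf K d p) g = measure_pmf.expectation (Pi_pmf I d p) g"
    by (rule expectation_Pi_pmf_subset[OF fin(1) sub(2) g, symmetric])
  finally show ?thesis .
qed

lemma prob_Int_Pi_pmf:
  assumes fin: "finite I" "\<And>i. i \<in> I \<Longrightarrow> finite (set_pmf (p i))"
    and sub: "J \<subseteq> I" "K \<subseteq> I" "J \<inter> K = {}"
    and S: "\<And>x y. (\<And>i. i \<in> J \<Longrightarrow> x i = y i) \<Longrightarrow> x \<in> S \<longleftrightarrow> y \<in> S"
    and T: "\<And>x y. (\<And>i. i \<in> K \<Longrightarrow> x i = y i) \<Longrightarrow> x \<in> T \<longleftrightarrow> y \<in> T"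
  shows "measure_pmf.prob (Pi_pmf I d p) (S \<inter> T) =
           measure_pmf.prob (Pi_pmf I d p) S * measure_pmf.prob (Pi_pmf I d p) T"
proof -
  have S': "indicator S x = (indicator S y :: real)" if "\<And>i. i \<in> J \<Longrightarrow> x i = y i" for x y
    using S[OF that] by (simp add: indicator_def)
  have T': "indicator T x = (indicator T y :: real)" if "\<And>i. i \<in> K \<Longrightarrow> x i = y i" for x y
    using T[OF that] by (simp add: indicator_def)
  have "measure_pmf.expectation (Pi_pmf I d p) (\<lambda>x. indicator S x * indicator T x :: real) =
          measure_pmf.expectation (Pi_pmf I d p) (indicator S) *
          measure_pmf.expectation (Pi_pmf I d p) (indicator T)"
    by (rule expectation_mult_Pi_pmf[OF fin sub S' T'])
  then show ?thesis by (simp flip: indicator_inter_arith)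
qed

lemma expectation_Pi_pmf_component:
  fixes f :: "'b \<Rightarrow> real"
  assumes "finite I" "i \<in> I"
  shows "measure_pmf.expectation (Pi_pmf I d p) (\<lambda>x. f (x i)) = measure_pmf.expectation (p i) f"
  using assms Pi_pmf_component[of I i d p] by (metis integral_map_pmf)

text \<open>Off the diagonal, independence gives products of means; adding the squared means on the
  diagonal completes the square of the total mean. Only the sum of the means has to vanish: in
  \<open>tilted_prob_ge\<close> they cancel between two families of hyperedges.\<close>

lemma second_moment_sum_Pi_pmf:
  fixes f :: "'i \<Rightarrow> 'b \<Rightarrow> real"
  assumes fin: "finite I" "\<And>i. i \<in> I \<Longrightarrow> finite (set_pmf (p i))"
    and mean: "(\<Sum>i\<in>I. measure_pmf.expectation (p i) (f i)) = 0"
  shows "measure_pmf.expectation (Pi_pmf I d p) (\<lambda>x. (\<Sum>i\<in>I. f i (x i))\<^sup>2)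
           \<le> (\<Sum>i\<in>I. measure_pmf.expectation (p i) (\<lambda>y. (f i y)\<^sup>2))"
proof -
  let ?E = "measure_pmf.expectation (Pi_pmf I d p)"
  define mu where "mu i = measure_pmf.expectation (p i) (f i)" for i
  have int: "integrable (Pi_pmf I d p) g" for g :: "('i \<Rightarrow> 'b) \<Rightarrow> real"
    by (intro integrable_measure_pmf_finite finite_set_Pi_pmf fin)
  have "?E (\<lambda>x. (\<Sum>i\<in>I. f i (x i))\<^sup>2) = (\<Sum>i\<in>I. \<Sum>j\<in>I. ?E (\<lambda>x. f i (x i) * f j (x j)))"
    by (simp add: power2_eq_square sum_product int)
  also have "\<dots> \<le> (\<Sum>i\<in>I. \<Sum>j\<in>I. mu i * mu j +
                  (if i = j then measure_pmf.expectation (p i) (\<lambda>y. (f i y)\<^sup>2) else 0))"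
  proof (intro sum_mono)
    fix i j assume ij: "i \<in> I" "j \<in> I"
    show "?E (\<lambda>x. f i (x i) * f j (x j)) \<le> mu i * mu j +
            (if i = j then measure_pmf.expectation (p i) (\<lambda>y. (f i y)\<^sup>2) else 0)"
    proof (cases "i = j")
      case True
      then show ?thesis using expectation_Pi_pmf_component[of I i d p "\<lambda>y. (f i y)\<^sup>2"] ij fin
        by (simp add: power2_eq_square)
    next
      case False
      have "?E (\<lambda>x. f i (x i) * f j (x j)) = ?E (\<lambda>x. f i (x i)) * ?E (\<lambda>x. f j (x j))"
        using False ij by (intro expectation_mult_Pi_pmf[where J = "{i}" and K = "{j}"] fin) auto
      with False ij fin show ?thesis
        by (simp add: expectation_Pi_pmf_component mu_def)
    qed
  qed
  also have "\<dots> = (\<Sum>i\<in>I. mu i)\<^sup>2 + (\<Sum>i\<in>I. measure_pmf.expectation (p i) (\<lambda>y. (f i y)\<^sup>2))"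
    using fin by (simp add: sum.distrib power2_eq_square sum_product)
  finally show ?thesis using mean by (simp add: mu_def)
qed

section \<open>Chebyshev's inequality and change of measure\<close>

lemma Chebyshev_pmf:
  fixes f :: "'a \<Rightarrow> real"
  assumes "finite (set_pmf M)" "a > 0"
  shows "measure_pmf.prob M {x. a \<le> \<bar>f x\<bar>} \<le> measure_pmf.expectation M (\<lambda>x. (f x)\<^sup>2) / a\<^sup>2"
proof -
  have "measure_pmf.prob M {x. a \<le> \<bar>f x\<bar>} = measure_pmf.prob M {x. a\<^sup>2 \<le> (f x)\<^sup>2}"
    using assms(2) by (intro arg_cong[where f = "measure_pmf.prob M"])
      (auto simp flip: abs_le_square_iff)
  also have "\<dots> \<le> measure_pmf.expectation M (\<lambda>x. (f x)\<^sup>2) / a\<^sup>2"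
    using integral_Markov_inequality_measure[of M "\<lambda>x. (f x)\<^sup>2" "{}" "a\<^sup>2"] assms
    by (simp add: integrable_measure_pmf_finite)
  finally show ?thesis .
qed

text \<open>The pointwise bound is summed over a common finite support. This carries probabilities
  from the tilted law back to the true one in \<open>flip_prob_ge_balanced\<close>.\<close>

lemma prob_mono_pmf:
  assumes "finite (set_pmf M)" "finite (set_pmf N)"
    and "\<And>x. x \<in> S \<Longrightarrow> c * pmf M x \<le> pmf N x"
  shows "c * measure_pmf.prob M S \<le> measure_pmf.prob N S"
proof -
  define T where "T = set_pmf M \<union> set_pmf N"
  have T: "finite T" using assms by (simp add: T_def)
  have eq: "measure_pmf.prob L S = (\<Sum>x\<in>S \<inter> T. pmf L x)" if "set_pmf L \<subseteq> T" for L
  proof -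
    have "measure_pmf.prob L S = measure_pmf.prob L (S \<inter> T)"
      using that by (intro measure_prob_cong_0) (auto simp: set_pmf_iff subset_iff)
    then show ?thesis using T by (simp add: measure_measure_pmf_finite)
  qed
  have "c * measure_pmf.prob M S = (\<Sum>x\<in>S \<inter> T. c * pmf M x)"
    by (subst eq) (auto simp: T_def sum_distrib_left)
  also have "\<dots> \<le> (\<Sum>x\<in>S \<inter> T. pmf N x)" by (intro sum_mono assms) auto
  also have "\<dots> = measure_pmf.prob N S" by (subst eq) (auto simp: T_def)
  finally show ?thesis .
qed

section \<open>The likelihood ratio of a single flip\<close>

definition edge_law :: "real \<Rightarrow> real \<Rightarrow> bool option pmf" where
  "edge_law a r = do {
     h \<leftarrow> bernoulli_pmf r;
     b \<leftarrow> bernoulli_pmf a;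
     return_pmf (if b then Some h else None)
   }"

lemma pmf_edge_law:
  assumes "a \<in> {0..1}" "r \<in> {0..1}"
  shows "pmf (edge_law a r) None = 1 - a"
    and "pmf (edge_law a r) (Some True) = a * r"
    and "pmf (edge_law a r) (Some False) = a * (1 - r)"
  using assms by (simp_all add: edge_law_def pmf_bind algebra_simps)

lemma expectation_edge_law:
  fixes f :: "bool option \<Rightarrow> real"
  assumes "a \<in> {0..1}" "r \<in> {0..1}"
  shows "measure_pmf.expectation (edge_law a r) f =
           (1 - a) * f None + a * r * f (Some True) + a * (1 - r) * f (Some False)"
proof -
  have "measure_pmf.expectation (edge_law a r) f =
          (\<Sum>x\<in>{None, Some True, Some False}. f x * pmf (edge_law a r) x)"
    by (rule integral_measure_pmf_real) (auto intro: bool.exhaust option.exhaust simp: UNIV_bool)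
  with assms show ?thesis by (simp add: pmf_edge_law)
qed

section \<open>Hellinger affinity, likelihood ratio and tilting for one hyperedge\<close>

definition hellinger_affinity :: "real \<Rightarrow> real \<Rightarrow> real" where
  "hellinger_affinity p q = sqrt (p * q) + sqrt ((1 - p) * (1 - q))"

text \<open>The affinity is the Bhattacharyya coefficient of two Bernoulli laws; expanding the
  squares expresses the denominator of \<open>recovery_threshold\<close> through its distance to
  1.\<close>

lemma hellinger_affinity_eq:
  assumes "p \<in> {0<..<1}" "q \<in> {0<..<1}"
  shows "(sqrt p - sqrt q)\<^sup>2 + (sqrt (1 - p) - sqrt (1 - q))\<^sup>2 = 2 * (1 - hellinger_affinity p q)"
  using assms by (simp add: hellinger_affinity_def power2_diff real_sqrt_mult)

lemma hellinger_affinity_bounds: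
  assumes "p \<in> {0<..<1}" "q \<in> {0<..<1}"
  shows "0 < hellinger_affinity p q" "hellinger_affinity p q \<le> 1"
proof -
  show "0 < hellinger_affinity p q"
    using assms by (auto simp: hellinger_affinity_def intro!: add_pos_pos)
  have "0 \<le> (sqrt p - sqrt q)\<^sup>2 + (sqrt (1 - p) - sqrt (1 - q))\<^sup>2" by simp
  then show "hellinger_affinity p q \<le> 1"
    unfolding hellinger_affinity_eq[OF assms] by simp
qed

text \<open>The log-likelihood ratio of \<open>q\<close> against \<open>p\<close> for one coordinate
  of the observation. The probability of being revealed cancels, so it is no parameter, and a
  censored value carries no evidence.\<close>

definition llr :: "real \<Rightarrow> real \<Rightarrow> bool option \<Rightarrow> real" where
  "llr p q x = (case x of None \<Rightarrow> 0 | Some h \<Rightarrow> if h then ln (q / p) else ln ((1 - q) / (1 - p)))"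

definition llr_bound :: "real \<Rightarrow> real \<Rightarrow> real" where
  "llr_bound p q = \<bar>ln (q / p)\<bar> + \<bar>ln ((1 - q) / (1 - p))\<bar>"

lemma llr_swap: "p \<in> {0<..<1} \<Longrightarrow> q \<in> {0<..<1} \<Longrightarrow> llr q p x = - llr p q x"
  by (auto simp: llr_def ln_div split: option.splits)

lemma abs_llr_le: "\<bar>llr p q x\<bar> \<le> llr_bound p q"
  by (auto simp: llr_def llr_bound_def split: option.splits)

text \<open>The product form, unlike a quotient, also covers values of probability 0, such as the
  revealed ones for \<open>a = 0\<close>.\<close>

lemma pmf_edge_law_llr:
  assumes "a \<in> {0..1}" "p \<in> {0<..<1}" "q \<in> {0<..<1}"
  shows "pmf (edge_law a q) x = exp (llr p q x) * pmf (edge_law a p) x"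
proof (cases x)
  case (Some h)
  then show ?thesis using assms by (cases h) (auto simp: llr_def pmf_edge_law)
qed (use assms in \<open>simp add: llr_def pmf_edge_law\<close>)

text \<open>The normalised geometric mean of \<open>edge_law a p\<close> and
  \<open>edge_law a q\<close>. It is again an \<open>edge_law\<close>: before normalisation the
  masses are \<open>1 - a\<close>, \<open>a * sqrt (p * q)\<close> and
  \<open>a * sqrt ((1 - p) * (1 - q))\<close>, with total \<open>1 - a * (1 - b)\<close>.\<close>

definition tilted_law :: "real \<Rightarrow> real \<Rightarrow> real \<Rightarrow> bool option pmf" where
  "tilted_law a p q = (let b = hellinger_affinity p q in
     edge_law (a * b / (1 - a * (1 - b))) (sqrt (p * q) / b))"

lemma tilted_law:
  assumes a: "a \<in> {0..1}" and p: "p \<in> {0<..<1}" and q: "q \<in> {0<..<1}"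
  shows "sqrt (pmf (edge_law a p) x * pmf (edge_law a q) x) =
           (1 - a * (1 - hellinger_affinity p q)) * pmf (tilted_law a p q) x"
    and "measure_pmf.expectation (tilted_law a p q) (\<lambda>x. (llr p q x)\<^sup>2) \<le> a * (llr_bound p q)\<^sup>2"
proof -
  define b where "b = hellinger_affinity p q"
  define Z where "Z = 1 - a * (1 - b)"
  define a' where "a' = a * b / Z"
  define r where "r = sqrt (p * q) / b"
  have b: "0 < b" "b \<le> 1" using hellinger_affinity_bounds[OF p q] by (simp_all add: b_def)
  \<comment> \<open>The normaliser \<open>Z\<close> is at least \<open>b\<close>, so the tilted law
    does not reveal more often than \<open>a\<close>. As \<open>llr\<close> vanishes on censored
    values, this yields the factor \<open>a\<close> in the second moment.\<close>
  have "a * (1 - b) \<le> 1 - b" using a b by (intro mult_left_le_one_le) auto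
  then have "b \<le> Z" by (simp add: Z_def)
  with b have Z: "0 < Z" by simp
  have a': "0 \<le> a'" "a' \<le> a"
    using a b Z \<open>b \<le> Z\<close> by (auto simp: a'_def divide_le_eq intro!: mult_left_mono)
  have r: "0 \<le> r" "r \<le> 1"
    using b p q by (auto simp: r_def divide_le_eq b_def hellinger_affinity_def)
  have T: "tilted_law a p q = edge_law a' r"
    by (simp add: tilted_law_def a'_def r_def Z_def b_def Let_def)
  have *: "a' \<in> {0..1}" "r \<in> {0..1}" using a a' r by auto
  have Za: "Z * a' = a * b" using Z by (simp add: a'_def)
  have br: "b * r = sqrt (p * q)" using b by (simp add: r_def)
  have br': "b * (1 - r) = sqrt ((1 - p) * (1 - q))"
  proof -
    have "b * (1 - r) = b - sqrt (p * q)" by (simp add: right_diff_distrib br)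
    then show ?thesis by (simp only: b_def hellinger_affinity_def add_diff_cancel_left')
  qed
  have "sqrt (pmf (edge_law a p) x * pmf (edge_law a q) x) = Z * pmf (edge_law a' r) x"
  proof (cases x)
    case None
    have "Z * (1 - a') = 1 - a" using Za by (simp add: right_diff_distrib) (simp add: Z_def algebra_simps)
    with None a p q * show ?thesis by (simp add: pmf_edge_law real_sqrt_mult)
  next
    case (Some h)
    have "sqrt ((a * p) * (a * q)) = a * sqrt (p * q)"
      using a by (simp add: real_sqrt_mult)
    moreover have "sqrt ((a * (1 - p)) * (a * (1 - q))) = a * sqrt ((1 - p) * (1 - q))"
      using a by (simp add: real_sqrt_mult)
    moreover have "Z * (a' * r) = a * sqrt (p * q)"
      using Za br by (metis mult.assoc)
    moreover have "Z * (a' * (1 - r)) = a * sqrt ((1 - p) * (1 - q))"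
      using Za br' by (metis mult.assoc)
    ultimately show ?thesis using Some a p q *
      by (cases h) (simp_all add: pmf_edge_law)
  qed
  then show "sqrt (pmf (edge_law a p) x * pmf (edge_law a q) x) =
      (1 - a * (1 - hellinger_affinity p q)) * pmf (tilted_law a p q) x"
    by (simp add: T Z_def b_def)
  have sq: "(llr p q x)\<^sup>2 \<le> (llr_bound p q)\<^sup>2" for x
    using abs_llr_le[of p q x] abs_ge_zero order_trans power2_le_iff_abs_le by blast
  have "measure_pmf.expectation (edge_law a' r) (\<lambda>x. (llr p q x)\<^sup>2) =
          a' * (r * (llr p q (Some True))\<^sup>2 + (1 - r) * (llr p q (Some False))\<^sup>2)"
    using * by (subst expectation_edge_law) (auto simp: llr_def algebra_simps)
  also have "\<dots> \<le> a' * (r * (llr_bound p q)\<^sup>2 + (1 - r) * (llr_bound p q)\<^sup>2)"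
    using a' r by (intro mult_left_mono add_mono sq) auto
  also have "\<dots> = a' * (llr_bound p q)\<^sup>2" by (simp add: algebra_simps)
  also have "\<dots> \<le> a * (llr_bound p q)\<^sup>2" using a' by (intro mult_right_mono) auto
  finally show "measure_pmf.expectation (tilted_law a p q) (\<lambda>x. (llr p q x)\<^sup>2) \<le> a * (llr_bound p q)\<^sup>2"
    by (simp add: T)
qed

section \<open>The likelihood change over families of hyperedges\<close>

lemma finite_set_Pi_edge_law: "finite I \<Longrightarrow> finite (set_pmf (Pi_pmf I None p))"
  for p :: "_ \<Rightarrow> bool option pmf"
  by (rule finite_set_Pi_pmf) auto

text \<open>\<open>L\<close> is the log-likelihood change when \<open>U\<close> passes from
  \<open>p\<close> to \<open>q\<close> and \<open>V\<close> from \<open>q\<close> to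
  \<open>p\<close>. All coordinates having the same tilted law, exchanging \<open>U\<close> and
  \<open>V\<close> turns \<open>L\<close> into \<open>- L\<close>; hence half of the mass that
  Chebyshev's inequality leaves for \<open>\<bar>L A\<bar> < x\<close> is available on the
  nonnegative side.\<close>

lemma tilted_prob_ge:
  fixes U V :: "'e set"
  assumes a: "a \<in> {0..1}" and p: "p \<in> {0<..<1}" and q: "q \<in> {0<..<1}"
    and fin: "finite U" "finite V" and disj: "U \<inter> V = {}" and card: "card U = card V"
    and x: "x > 0"
  defines "L \<equiv> \<lambda>A. (\<Sum>e\<in>U. llr p q (A e)) - (\<Sum>e\<in>V. llr p q (A e))"
  shows "(1 - 2 * real (card U) * a * (llr_bound p q)\<^sup>2 / x\<^sup>2) / 2 \<le>
           measure_pmf.prob (Pi_pmf (U \<union> V) None (\<lambda>_. tilted_law a p q)) {A. 0 \<le> L A \<and> L A \<le> x}"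
proof -
  define T where "T = Pi_pmf (U \<union> V) None (\<lambda>_. tilted_law a p q)"
  define s where "s e = (if e \<in> U then 1 else - 1 :: real)" for e
  have finT: "finite (set_pmf T)" using fin by (simp add: T_def finite_set_Pi_edge_law)
  have L: "L A = (\<Sum>e\<in>U \<union> V. s e * llr p q (A e))" for A
    using fin disj by (subst sum.union_disjoint)
      (auto simp: L_def s_def sum_negf[symmetric] intro!: sum.cong)
  obtain b where b: "bij_betw b U V" using finite_same_card_bij[OF fin card] by blast
  \<comment> \<open>\<open>h\<close> exchanges \<open>U\<close> and \<open>V\<close>. It is the
    identity elsewhere because \<open>Pi_pmf_bij_betw\<close> requires points outside the index set
    to stay outside.\<close>
  define h where "h e = (if e \<in> U then b e else if e \<in> V then inv_into U b e else e)" for e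
  have b': "bij_betw (inv_into U b) V U" using b by (rule bij_betw_inv_into)
  have hU: "bij_betw h U V" using b by (subst bij_betw_cong[of _ _ b]) (auto simp: h_def)
  have hV: "bij_betw h V U"
    using b' disj by (subst bij_betw_cong[of _ _ "inv_into U b"]) (auto simp: h_def)
  have h: "bij_betw h (U \<union> V) (U \<union> V)"
    using bij_betw_combine[OF hU hV] disj by (simp add: Un_commute Int_commute)
  have sym: "T = map_pmf (\<lambda>g. g \<circ> h) T" unfolding T_def
    by (rule Pi_pmf_bij_betw) (use fin h in \<open>auto simp: h_def\<close>)
  have Lh: "L (g \<circ> h) = - L g" for g
    using sum.reindex_bij_betw[OF hU, of "\<lambda>e. llr p q (g e)"]
      sum.reindex_bij_betw[OF hV, of "\<lambda>e. llr p q (g e)"] by (simp add: L_def)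
  have eq: "measure_pmf.prob T {A. 0 \<le> L A \<and> L A \<le> x} = measure_pmf.prob T {A. -x \<le> L A \<and> L A \<le> 0}"
    by (subst sym) (auto simp: Lh vimage_def intro!: arg_cong[where f = "measure_pmf.prob T"])
  \<comment> \<open>A single mean need not vanish under the tilt; the means over \<open>U\<close>
    and \<open>V\<close> cancel because the two sets have equal size.\<close>
  have "(\<Sum>e\<in>U \<union> V. measure_pmf.expectation (tilted_law a p q) (\<lambda>y. s e * llr p q y)) = 0"
  proof -
    have "(\<Sum>e\<in>V. measure_pmf.expectation (tilted_law a p q) (\<lambda>y. s e * llr p q y)) =
            (\<Sum>e\<in>V. - measure_pmf.expectation (tilted_law a p q) (llr p q))"
      using disj by (intro sum.cong) (auto simp: s_def)
    then show ?thesis using fin disj card by (subst sum.union_disjoint) (auto simp: s_def)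
  qed
  from second_moment_sum_Pi_pmf[OF _ _ this, of None] fin
  have "measure_pmf.expectation T (\<lambda>A. (L A)\<^sup>2) \<le>
          (\<Sum>e\<in>U \<union> V. measure_pmf.expectation (tilted_law a p q) (\<lambda>y. (s e * llr p q y)\<^sup>2))"
    by (simp add: T_def L)
  also have "\<dots> \<le> (\<Sum>e\<in>U \<union> V. a * (llr_bound p q)\<^sup>2)"
    using tilted_law(2)[OF a p q] by (intro sum_mono) (simp add: s_def power_mult_distrib)
  also have "\<dots> = 2 * real (card U) * a * (llr_bound p q)\<^sup>2"
    using fin disj card by (simp add: card_Un_disjoint)
  finally have V: "measure_pmf.expectation T (\<lambda>A. (L A)\<^sup>2) \<le> 2 * real (card U) * a * (llr_bound p q)\<^sup>2" .
  have "1 = measure_pmf.prob T UNIV" by simp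
  also have "UNIV = {A. x \<le> \<bar>L A\<bar>} \<union> ({A. 0 \<le> L A \<and> L A \<le> x} \<union> {A. -x \<le> L A \<and> L A \<le> 0})"
    by auto
  also have "measure_pmf.prob T \<dots> \<le> measure_pmf.prob T {A. x \<le> \<bar>L A\<bar>} +
      (measure_pmf.prob T {A. 0 \<le> L A \<and> L A \<le> x} + measure_pmf.prob T {A. -x \<le> L A \<and> L A \<le> 0})"
    by (intro order_trans[OF measure_Un_le] add_mono order_refl) auto
  also have "measure_pmf.prob T {A. x \<le> \<bar>L A\<bar>} \<le> 2 * real (card U) * a * (llr_bound p q)\<^sup>2 / x\<^sup>2"
    using order_trans[OF Chebyshev_pmf[OF finT x] divide_right_mono[OF V]] by simp
  finally show ?thesis using eq unfolding T_def by simp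
qed

text \<open>Change of measure: with \<open>Z\<close> the normaliser of one tilt, the tilted product
  mass times \<open>Z ^ (2 * card U)\<close> equals \<open>exp (L A / 2)\<close> times the true
  mass. On \<open>0 \<le> L A \<le> x\<close> the exponential is at most \<open>exp (x / 2)\<close>,
  which is the price of returning from the tilted law.\<close>

lemma flip_prob_ge_balanced:
  fixes U V :: "'e set"
  assumes a: "a \<in> {0..1}" and p: "p \<in> {0<..<1}" and q: "q \<in> {0<..<1}"
    and fin: "finite U" "finite V" and disj: "U \<inter> V = {}" and card: "card U = card V"
    and x: "x > 0"
    and f: "\<And>e. e \<in> U \<Longrightarrow> f e = p" "\<And>e. e \<in> V \<Longrightarrow> f e = q"
  defines "L \<equiv> \<lambda>A. (\<Sum>e\<in>U. llr p q (A e)) - (\<Sum>e\<in>V. llr p q (A e))"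
  shows "(1 - a * (1 - hellinger_affinity p q)) ^ (2 * card U) * exp (- x / 2) *
           ((1 - 2 * real (card U) * a * (llr_bound p q)\<^sup>2 / x\<^sup>2) / 2) \<le>
           measure_pmf.prob (Pi_pmf (U \<union> V) None (\<lambda>e. edge_law a (f e))) {A. 0 \<le> L A}"
proof -
  define Z where "Z = 1 - a * (1 - hellinger_affinity p q)"
  define T where "T = Pi_pmf (U \<union> V) None (\<lambda>_. tilted_law a p q)"
  define M where "M = Pi_pmf (U \<union> V) None (\<lambda>e. edge_law a (f e))"
  have finTM: "finite (set_pmf T)" "finite (set_pmf M)"
    using fin by (simp_all add: T_def M_def finite_set_Pi_edge_law)
  have "a * (1 - hellinger_affinity p q) \<le> 1 * 1"
    using a hellinger_affinity_bounds[OF p q] by (intro mult_mono) auto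
  then have Z: "0 \<le> Z" by (simp add: Z_def)
  have "Z ^ (2 * card U) * exp (- x / 2) * pmf T A \<le> pmf M A" if "0 \<le> L A" "L A \<le> x" for A
  proof (cases "\<forall>e. e \<notin> U \<union> V \<longrightarrow> A e = None")
    case False
    then have "pmf T A = 0" using fin unfolding T_def by (intro pmf_Pi_outside) auto
    then show ?thesis by simp
  next
    case True
    have *: "Z * pmf (tilted_law a p q) y = exp (llr p q y / 2) * pmf (edge_law a p) y" for y
    proof -
      have "exp (llr p q y / 2) * pmf (edge_law a p) y =
              sqrt (exp (llr p q y / 2) ^ 2 * pmf (edge_law a p) y ^ 2)"
        by (simp add: real_sqrt_mult)
      also have "exp (llr p q y / 2) ^ 2 = exp (llr p q y)"
        by (simp flip: exp_double)
      also have "exp (llr p q y) * pmf (edge_law a p) y ^ 2 =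
                 pmf (edge_law a p) y * pmf (edge_law a q) y"
        using pmf_edge_law_llr[OF a p q, of y] by (simp add: power2_eq_square)
      finally show ?thesis using tilted_law(1)[OF a p q, of y] by (simp add: Z_def)
    qed
    \<comment> \<open>On \<open>V\<close> the true law has parameter \<open>q\<close>, so
      \<open>llr\<close> enters with the opposite sign; together the two families produce
      \<open>exp (L A / 2)\<close>.\<close>
    have **: "Z * pmf (tilted_law a p q) y = exp (- llr p q y / 2) * pmf (edge_law a q) y" for y
      using *[of y] pmf_edge_law_llr[OF a p q, of y] by (simp add: exp_minus exp_add[symmetric] mult.assoc[symmetric] flip: exp_minus)
    have "Z ^ (2 * card U) * pmf T A = (\<Prod>e\<in>U \<union> V. Z * pmf (tilted_law a p q) (A e))"
      using fin disj card True unfolding T_def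
      by (subst pmf_Pi') (auto simp: prod.distrib card_Un_disjoint mult_2)
    also have "\<dots> = (\<Prod>e\<in>U. exp (llr p q (A e) / 2) * pmf (edge_law a (f e)) (A e)) *
                    (\<Prod>e\<in>V. exp (- llr p q (A e) / 2) * pmf (edge_law a (f e)) (A e))"
    proof -
      have "(\<Prod>e\<in>U. Z * pmf (tilted_law a p q) (A e)) =
              (\<Prod>e\<in>U. exp (llr p q (A e) / 2) * pmf (edge_law a (f e)) (A e))"
        by (intro prod.cong refl) (simp only: f *)
      moreover have "(\<Prod>e\<in>V. Z * pmf (tilted_law a p q) (A e)) =
              (\<Prod>e\<in>V. exp (- llr p q (A e) / 2) * pmf (edge_law a (f e)) (A e))"
        by (intro prod.cong refl) (simp only: f **)
      ultimately show ?thesis using fin disj by (simp add: prod.union_disjoint)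
    qed
    also have "\<dots> = exp (L A / 2) * pmf M A"
    proof -
      have "exp (L A / 2) = (\<Prod>e\<in>U. exp (llr p q (A e) / 2)) * (\<Prod>e\<in>V. exp (- llr p q (A e) / 2))"
        using fin by (simp flip: exp_sum exp_add
          add: L_def sum_divide_distrib diff_divide_distrib sum_negf)
      moreover have "pmf M A = (\<Prod>e\<in>U. pmf (edge_law a (f e)) (A e)) * (\<Prod>e\<in>V. pmf (edge_law a (f e)) (A e))"
        using fin disj True unfolding M_def
        by (subst pmf_Pi') (auto simp: prod.union_disjoint)
      ultimately show ?thesis by (simp add: prod.distrib)
    qed
    also have "\<dots> \<le> exp (x / 2) * pmf M A" using that by (intro mult_right_mono) auto
    finally show ?thesis by (simp add: exp_minus field_simps)
  qed
  then have "Z ^ (2 * card U) * exp (- x / 2) * measure_pmf.prob T {A. 0 \<le> L A \<and> L A \<le> x} \<le>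
               measure_pmf.prob M {A. 0 \<le> L A \<and> L A \<le> x}"
    by (intro prob_mono_pmf finTM) auto
  also have "\<dots> \<le> measure_pmf.prob M {A. 0 \<le> L A}"
    by (intro measure_pmf.finite_measure_mono) auto
  finally have le: "Z ^ (2 * card U) * exp (- x / 2) * measure_pmf.prob T {A. 0 \<le> L A \<and> L A \<le> x} \<le>
                 measure_pmf.prob M {A. 0 \<le> L A}" .
  have "(1 - 2 * real (card U) * a * (llr_bound p q)\<^sup>2 / x\<^sup>2) / 2 \<le>
          measure_pmf.prob T {A. 0 \<le> L A \<and> L A \<le> x}"
    unfolding T_def L_def by (rule tilted_prob_ge[OF a p q fin disj card x])
  with Z show ?thesis unfolding Z_def[symmetric] M_def[symmetric]
    by (intro order_trans[OF mult_left_mono le]) auto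
qed

lemma prob_None_Pi_edge_law:
  assumes "finite I" "W \<subseteq> I" "a \<in> {0..1}" "\<And>e. e \<in> I \<Longrightarrow> f e \<in> {0..1}"
  shows "measure_pmf.prob (Pi_pmf I None (\<lambda>e. edge_law a (f e))) {A. \<forall>e\<in>W. A e = None} =
           (1 - a) ^ card W"
proof -
  have W: "finite W" using assms finite_subset by blast
  have "measure_pmf.prob (Pi_pmf I None (\<lambda>e. edge_law a (f e))) {A. \<forall>e\<in>W. A e = None} =
        measure_pmf.prob (Pi_pmf W None (\<lambda>e. edge_law a (f e))) (Pi W (\<lambda>_. {None}))"
  proof (subst prob_Pi_pmf_subset[where J = W, OF assms(1,2)])
    show "A \<in> {A. \<forall>e\<in>W. A e = None} \<longleftrightarrow> B \<in> {A. \<forall>e\<in>W. A e = None}"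
      if "\<And>e. e \<in> W \<Longrightarrow> A e = B e" for A B :: "'a \<Rightarrow> bool option"
      by (simp add: that)
  qed (simp add: Pi_def Ball_def)
  also have "\<dots> = (\<Prod>e\<in>W. 1 - a)"
    using assms W by (subst measure_Pi_pmf_Pi) (auto simp: measure_pmf_single pmf_edge_law subset_iff intro!: prod.cong)
  finally show ?thesis by simp
qed

text \<open>\<open>f\<close> and \<open>g\<close> are the hyperedge probabilities before and after a
  flip, and \<open>W\<close> is the surplus left when the two affected families are cut to equal
  size. Censoring all of \<open>W\<close> is independent of \<open>L\<close>, costs
  \<open>(1 - a) ^ card W\<close>, and makes \<open>L\<close> the whole log-likelihood
  change.\<close>

lemma flip_prob_ge:
  fixes I U V W :: "'e set"
  assumes a: "a \<in> {0..1}" and p: "p \<in> {0<..<1}" and q: "q \<in> {0<..<1}"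
    and fin: "finite I" and sub: "U \<subseteq> I" "V \<subseteq> I" "W \<subseteq> I"
    and disj: "U \<inter> V = {}" "U \<inter> W = {}" "V \<inter> W = {}" and card: "card U = card V"
    and x: "x > 0"
    and fg: "\<And>e. e \<in> I \<Longrightarrow> f e \<in> {0<..<1}" "\<And>e. e \<in> I \<Longrightarrow> g e \<in> {0<..<1}"
    and U: "\<And>e. e \<in> U \<Longrightarrow> f e = p \<and> g e = q" and V: "\<And>e. e \<in> V \<Longrightarrow> f e = q \<and> g e = p"
    and rest: "\<And>e. e \<in> I \<Longrightarrow> e \<notin> U \<union> V \<union> W \<Longrightarrow> f e = g e"
  shows "(1 - a * (1 - hellinger_affinity p q)) ^ (2 * card U) * exp (- x / 2) *
           ((1 - 2 * real (card U) * a * (llr_bound p q)\<^sup>2 / x\<^sup>2) / 2) * (1 - a) ^ card W \<le>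
         measure_pmf.prob (Pi_pmf I None (\<lambda>e. edge_law a (f e)))
           {A. (\<Prod>e\<in>I. pmf (edge_law a (f e)) (A e)) \<le> (\<Prod>e\<in>I. pmf (edge_law a (g e)) (A e))}"
    (is "?c * _ \<le> measure_pmf.prob ?M ?G")
proof -
  define L where "L A = (\<Sum>e\<in>U. llr p q (A e)) - (\<Sum>e\<in>V. llr p q (A e))" for A
  have finU: "finite U" "finite V" "finite W" using fin sub finite_subset by blast+
  have Lcong: "L A = L B" if "\<And>e. e \<in> U \<union> V \<Longrightarrow> A e = B e" for A B
    using that by (simp add: L_def)
  have f01: "f e \<in> {0..1}" if "e \<in> I" for e using fg(1)[OF that] by auto
  have "?c \<le> measure_pmf.prob (Pi_pmf (U \<union> V) None (\<lambda>e. edge_law a (f e))) {A. 0 \<le> L A}"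
    unfolding L_def using U V by (intro flip_prob_ge_balanced a p q finU disj card x) auto
  also have "\<dots> = measure_pmf.prob ?M {A. 0 \<le> L A}"
  proof (rule prob_Pi_pmf_subset[symmetric, OF fin])
    show "A \<in> {A. 0 \<le> L A} \<longleftrightarrow> B \<in> {A. 0 \<le> L A}" if "\<And>e. e \<in> U \<union> V \<Longrightarrow> A e = B e" for A B
      using Lcong[OF that] by simp
  qed (use sub in auto)
  finally have c: "?c \<le> measure_pmf.prob ?M {A. 0 \<le> L A}" .
  have W: "measure_pmf.prob ?M {A. \<forall>e\<in>W. A e = None} = (1 - a) ^ card W"
    by (rule prob_None_Pi_edge_law[where f = f, OF fin sub(3) a f01])
  have "?c * (1 - a) ^ card W \<le>
      measure_pmf.prob ?M {A. 0 \<le> L A} * measure_pmf.prob ?M {A. \<forall>e\<in>W. A e = None}"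
    unfolding W using a by (intro mult_right_mono c) auto
  also have "\<dots> = measure_pmf.prob ?M ({A. 0 \<le> L A} \<inter> {A. \<forall>e\<in>W. A e = None})"
  proof (rule prob_Int_Pi_pmf[where J = "U \<union> V" and K = W, symmetric, OF fin])
    show "A \<in> {A. 0 \<le> L A} \<longleftrightarrow> B \<in> {A. 0 \<le> L A}" if "\<And>e. e \<in> U \<union> V \<Longrightarrow> A e = B e" for A B
      using Lcong[OF that] by simp
  qed (use sub disj in auto)
  also have "\<dots> \<le> measure_pmf.prob ?M ?G"
  proof (intro measure_pmf.finite_measure_mono subsetI)
    fix A assume A: "A \<in> {A. 0 \<le> L A} \<inter> {A. \<forall>e\<in>W. A e = None}"
    \<comment> \<open>\<open>exp (w e)\<close> is the factor by which the flip changes the mass of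
      coordinate \<open>e\<close>. It is 1 on \<open>W\<close>, where a censored value has mass
      \<open>1 - a\<close> under either probability, and off the three sets, where
      \<open>f e = g e\<close>.\<close>
    define w where "w e = (if e \<in> U then llr p q (A e) else if e \<in> V then - llr p q (A e) else 0)" for e
    have g: "pmf (edge_law a (g e)) (A e) = exp (w e) * pmf (edge_law a (f e)) (A e)" if e: "e \<in> I" for e
    proof -
      consider "e \<in> U" | "e \<in> V" | "e \<in> W" | "e \<notin> U \<union> V \<union> W" by blast
      then show ?thesis
      proof cases
        case 1
        then show ?thesis using U pmf_edge_law_llr[OF a p q] by (simp add: w_def)
      next
        case 2
        then show ?thesis using V pmf_edge_law_llr[OF a q p] disj llr_swap[OF p q]
          by (auto simp add: w_def)
      next
        case 3
        moreover have "e \<notin> U" "e \<notin> V" using disj 3 by auto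
        ultimately show ?thesis using A a fg[OF e] by (auto simp: w_def pmf_edge_law)
      next
        case 4
        then show ?thesis using rest[OF e] by (simp add: w_def)
      qed
    qed
    have "(\<Sum>e\<in>I. w e) = (\<Sum>e\<in>U \<union> V. w e)"
      using sub fin by (intro sum.mono_neutral_right) (auto simp: w_def)
    also have "\<dots> = L A" using finU disj
      by (subst sum.union_disjoint) (auto simp: w_def L_def sum_negf[symmetric] intro!: sum.cong)
    finally have w: "(\<Sum>e\<in>I. w e) = L A" .
    have "(\<Prod>e\<in>I. pmf (edge_law a (g e)) (A e)) = exp (L A) * (\<Prod>e\<in>I. pmf (edge_law a (f e)) (A e))"
      using fin g by (simp add: prod.distrib w flip: exp_sum)
    moreover have "1 * (\<Prod>e\<in>I. pmf (edge_law a (f e)) (A e)) \<le> exp (L A) * (\<Prod>e\<in>I. pmf (edge_law a (f e)) (A e))"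
      using A by (intro mult_right_mono prod_nonneg) auto
    ultimately show "A \<in> ?G" by simp
  qed auto
  finally show ?thesis .
qed

section \<open>Labelings at least as likely as the true one\<close>

text \<open>If at least \<open>K\<close> parameters are no less likely than \<open>\<theta>\<close>
  at \<open>A\<close>, then \<open>K\<close> times the mass of \<open>\<theta>\<close> at
  \<open>A\<close> is at most the mass of all parameters there. For each \<open>A\<close> at most
  one \<open>\<theta>\<close> equals \<open>est A\<close>, so summing over \<open>A\<close> gives at
  most the total mass \<open>card \<Theta>\<close>.\<close>

lemma sum_prob_est_le:
  fixes D :: "'t \<Rightarrow> 'a pmf"
  assumes fin: "finite \<Theta>" "\<And>\<theta>. \<theta> \<in> \<Theta> \<Longrightarrow> finite (set_pmf (D \<theta>))" and K: "K > 0"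
  shows "(\<Sum>\<theta>\<in>\<Theta>. measure_pmf.prob (D \<theta>)
            {A. est A = \<theta> \<and> K \<le> real (card {\<theta>' \<in> \<Theta>. pmf (D \<theta>) A \<le> pmf (D \<theta>') A})}) \<le>
         real (card \<Theta>) / K"
proof -
  define \<Omega> where "\<Omega> = (\<Union>\<theta>\<in>\<Theta>. set_pmf (D \<theta>))"
  have \<Omega>: "finite \<Omega>" using fin by (simp add: \<Omega>_def)
  have prob_eq: "measure_pmf.prob (D \<theta>) E = (\<Sum>A\<in>\<Omega>. if A \<in> E then pmf (D \<theta>) A else 0)" if "\<theta> \<in> \<Theta>" for \<theta> E
  proof -
    have "measure_pmf.prob (D \<theta>) E = measure_pmf.prob (D \<theta>) (\<Omega> \<inter> E)"
      using that by (intro measure_prob_cong_0) (auto simp: \<Omega>_def set_pmf_iff)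
    then show ?thesis using \<Omega> by (simp add: measure_measure_pmf_finite sum.inter_restrict)
  qed
  have "K * (\<Sum>\<theta>\<in>\<Theta>. measure_pmf.prob (D \<theta>)
            {A. est A = \<theta> \<and> K \<le> real (card {\<theta>' \<in> \<Theta>. pmf (D \<theta>) A \<le> pmf (D \<theta>') A})}) =
      (\<Sum>\<theta>\<in>\<Theta>. \<Sum>A\<in>\<Omega>. K * (if est A = \<theta> \<and> K \<le> real (card {\<theta>' \<in> \<Theta>. pmf (D \<theta>) A \<le> pmf (D \<theta>') A})
                          then pmf (D \<theta>) A else 0))"
    by (simp add: prob_eq sum_distrib_left)
  also have "\<dots> \<le> (\<Sum>\<theta>\<in>\<Theta>. \<Sum>A\<in>\<Omega>. if est A = \<theta> then \<Sum>\<theta>'\<in>\<Theta>. pmf (D \<theta>') A else 0)"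
  proof (intro sum_mono)
    fix \<theta> A
    define R where "R = {\<theta>' \<in> \<Theta>. pmf (D \<theta>) A \<le> pmf (D \<theta>') A}"
    have "K * pmf (D \<theta>) A \<le> (\<Sum>\<theta>'\<in>\<Theta>. pmf (D \<theta>') A)" if "K \<le> real (card R)"
    proof -
      have "K * pmf (D \<theta>) A \<le> (\<Sum>\<theta>'\<in>R. pmf (D \<theta>) A)"
        using that by (simp add: mult_right_mono)
      also have "\<dots> \<le> (\<Sum>\<theta>'\<in>R. pmf (D \<theta>') A)" by (intro sum_mono) (simp add: R_def)
      also have "\<dots> \<le> (\<Sum>\<theta>'\<in>\<Theta>. pmf (D \<theta>') A)"
        using fin by (intro sum_mono2) (auto simp: R_def)
      finally show ?thesis .
    qed
    then show "K * (if est A = \<theta> \<and> K \<le> real (card {\<theta>' \<in> \<Theta>. pmf (D \<theta>) A \<le> pmf (D \<theta>') A})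
                then pmf (D \<theta>) A else 0) \<le> (if est A = \<theta> then \<Sum>\<theta>'\<in>\<Theta>. pmf (D \<theta>') A else 0)"
      by (auto simp: R_def sum_nonneg)
  qed
  also have "\<dots> = (\<Sum>A\<in>\<Omega>. \<Sum>\<theta>\<in>\<Theta>. if est A = \<theta> then \<Sum>\<theta>'\<in>\<Theta>. pmf (D \<theta>') A else 0)"
    by (rule sum.swap)
  also have "\<dots> \<le> (\<Sum>A\<in>\<Omega>. \<Sum>\<theta>'\<in>\<Theta>. pmf (D \<theta>') A)"
    using fin by (intro sum_mono[of \<Omega>]) (simp add: sum_nonneg)
  also have "\<dots> = (\<Sum>\<theta>'\<in>\<Theta>. measure_pmf.prob (D \<theta>') UNIV)"
    by (subst sum.swap) (rule sum.cong, simp, subst prob_eq, simp_all)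
  also have "\<dots> = real (card \<Theta>)" by simp
  finally show ?thesis using K by (simp add: field_simps)
qed

text \<open>Second moment method with two families: the \<open>G i\<close> have no positive pairwise
  correlation, while the subevents \<open>H i\<close>, which are the ones counted, may depend on
  each other but lose at most a proportion \<open>\<eta>\<close>. The second moment of the count is
  bounded through \<open>G\<close>, its mean from below through \<open>\<eta>\<close>.\<close>

lemma prob_count_le_half_mean:
  fixes G H :: "'i \<Rightarrow> 'a set"
  assumes finM: "finite (set_pmf M)" and finS: "finite S"
    and HG: "\<And>i. i \<in> S \<Longrightarrow> H i \<subseteq> G i"
    and H: "\<And>i. i \<in> S \<Longrightarrow> (1 - \<eta>) * measure_pmf.prob M (G i) \<le> measure_pmf.prob M (H i)"
    and G: "\<And>i j. i \<in> S \<Longrightarrow> j \<in> S \<Longrightarrow> i \<noteq> j \<Longrightarrow>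
               measure_pmf.prob M (G i \<inter> G j) \<le> measure_pmf.prob M (G i) * measure_pmf.prob M (G j)"
  defines "\<mu> \<equiv> \<Sum>i\<in>S. measure_pmf.prob M (G i)"
  assumes \<mu>: "\<mu> > 0"
  shows "measure_pmf.prob M {x. real (card {i\<in>S. x \<in> H i}) \<le> \<mu> / 2} \<le> 4 / \<mu> + 8 * \<eta>"
proof -
  let ?E = "measure_pmf.expectation M"
  define N where "N x = (\<Sum>i\<in>S. indicator (H i) x :: real)" for x
  have N: "real (card {i\<in>S. x \<in> H i}) = N x" for x
    using finS by (simp add: N_def indicator_def sum.If_cases Int_def)
  have int: "integrable M f" for f :: "'a \<Rightarrow> real"
    by (rule integrable_measure_pmf_finite[OF finM])
  have "?E (\<lambda>x. (N x)\<^sup>2) = (\<Sum>i\<in>S. \<Sum>j\<in>S. measure_pmf.prob M (H i \<inter> H j))"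
    by (simp add: N_def power2_eq_square sum_product int flip: indicator_inter_arith)
  also have "\<dots> \<le> (\<Sum>i\<in>S. \<Sum>j\<in>S. measure_pmf.prob M (G i) * measure_pmf.prob M (G j) +
                     (if i = j then measure_pmf.prob M (G i) else 0))"
  proof (intro sum_mono)
    fix i j assume ij: "i \<in> S" "j \<in> S"
    have "measure_pmf.prob M (H i \<inter> H j) \<le> measure_pmf.prob M (G i \<inter> G j)"
      using HG ij by (intro measure_pmf.finite_measure_mono) auto
    then show "measure_pmf.prob M (H i \<inter> H j) \<le> measure_pmf.prob M (G i) * measure_pmf.prob M (G j) +
                     (if i = j then measure_pmf.prob M (G i) else 0)"
      using G[OF ij] by (cases "i = j") (auto intro: order_trans add_increasing)
  qed
  also have "\<dots> = \<mu>\<^sup>2 + \<mu>"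
    using finS by (simp add: sum.distrib power2_eq_square sum_product \<mu>_def)
  finally have N2: "?E (\<lambda>x. (N x)\<^sup>2) \<le> \<mu>\<^sup>2 + \<mu>" .
  have "(1 - \<eta>) * \<mu> \<le> (\<Sum>i\<in>S. measure_pmf.prob M (H i))"
    unfolding \<mu>_def sum_distrib_left by (intro sum_mono H)
  also have "\<dots> = ?E N" by (simp add: N_def[abs_def] int)
  finally have N1: "\<mu> * ((1 - \<eta>) * \<mu>) \<le> \<mu> * ?E N" using \<mu> by simp
  \<comment> \<open>Centring at \<open>\<mu>\<close> instead of the mean of \<open>N\<close> makes a
    lower bound on that mean sufficient.\<close>
  have "?E (\<lambda>x. (N x - \<mu>)\<^sup>2) = ?E (\<lambda>x. (N x)\<^sup>2) - 2 * (\<mu> * ?E N) + \<mu>\<^sup>2"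
    by (simp add: power2_diff int algebra_simps)
  also have "\<dots> \<le> \<mu> + 2 * \<eta> * \<mu>\<^sup>2"
    using N1 N2 by (simp add: power2_eq_square algebra_simps)
  finally have V: "?E (\<lambda>x. (N x - \<mu>)\<^sup>2) \<le> \<mu> + 2 * \<eta> * \<mu>\<^sup>2" .
  have "measure_pmf.prob M {x. N x \<le> \<mu> / 2} \<le> measure_pmf.prob M {x. \<mu> / 2 \<le> \<bar>N x - \<mu>\<bar>}"
    by (intro measure_pmf.finite_measure_mono) (auto simp: abs_if)
  also have "\<dots> \<le> ?E (\<lambda>x. (N x - \<mu>)\<^sup>2) / (\<mu> / 2)\<^sup>2"
    using \<mu> by (intro Chebyshev_pmf finM) auto
  also have "\<dots> \<le> (\<mu> + 2 * \<eta> * \<mu>\<^sup>2) / (\<mu> / 2)\<^sup>2" by (intro divide_right_mono V) auto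
  also have "\<dots> = 4 / \<mu> + 8 * \<eta>" using \<mu> by (simp add: field_simps power2_eq_square)
  finally show ?thesis by (simp add: N)
qed

section \<open>The observation given the labels as a product law\<close>

definition obs_law :: "nat \<Rightarrow> nat \<Rightarrow> real \<Rightarrow> real \<Rightarrow> real \<Rightarrow> (nat \<Rightarrow> int) \<Rightarrow> observation pmf" where
  "obs_law m n p q a \<sigma> = Pi_pmf (nsets {1..n} m) None (\<lambda>e. edge_law a (edge_prob n p q \<sigma> e))"

lemma finite_nsets_atLeastAtMost [simp]: "finite (nsets {k..n::nat} m)"
  by (simp add: finite_imp_finite_nsets)

lemma finite_set_obs_law: "finite (set_pmf (obs_law m n p q a \<sigma>))"
  unfolding obs_law_def by (intro finite_set_Pi_edge_law finite_nsets_atLeastAtMost)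

text \<open>Sampling all of \<open>H\<close> and then all of \<open>R\<close> is the same as
  sampling the pair separately for each \<open>m\<close>-subset, by \<open>Pi_pmf_bind\<close>;
  \<open>edge_law\<close> is the law of the result for one subset.\<close>

lemma censored_hsbm_eq:
  "censored_hsbm m n p q a = prior n \<bind> (\<lambda>\<sigma>. map_pmf (Pair \<sigma>) (obs_law m n p q a \<sigma>))"
proof -
  have "do {
       H \<leftarrow> Pi_pmf (nsets {1..n} m) False (\<lambda>e. bernoulli_pmf (edge_prob n p q \<sigma> e));
       R \<leftarrow> Pi_pmf (nsets {1..n} m) False (\<lambda>_. bernoulli_pmf a);
       return_pmf (\<sigma>, \<lambda>e. if R e then Some (H e) else None)
     } = map_pmf (Pair \<sigma>) (obs_law m n p q a \<sigma>)" for \<sigma>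
  proof -
    let ?X = "nsets {1..n} m"
    \<comment> \<open>Off the \<open>m\<close>-subsets \<open>R\<close> has its default
      \<open>False\<close>, so the observation of the model is \<open>None\<close> there, in
      agreement with the default of \<open>obs_law\<close>.\<close>
    have R: "R e \<Longrightarrow> e \<in> ?X" if "R \<in> set_pmf (Pi_pmf ?X False (\<lambda>_. bernoulli_pmf a))" for R e
      using subsetD[OF set_Pi_pmf_subset[OF finite_nsets_atLeastAtMost] that] by blast
    have "obs_law m n p q a \<sigma> = do {
       H \<leftarrow> Pi_pmf ?X False (\<lambda>e. bernoulli_pmf (edge_prob n p q \<sigma> e));
       R \<leftarrow> Pi_pmf ?X False (\<lambda>_. bernoulli_pmf a);
       return_pmf (\<lambda>e. if e \<in> ?X then if R e then Some (H e) else None else None)}"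
      by (simp add: obs_law_def edge_law_def finite_nsets_atLeastAtMost Pi_pmf_bind[where d' = False])
    also have "\<dots> = do {
       H \<leftarrow> Pi_pmf ?X False (\<lambda>e. bernoulli_pmf (edge_prob n p q \<sigma> e));
       R \<leftarrow> Pi_pmf ?X False (\<lambda>_. bernoulli_pmf a);
       return_pmf (\<lambda>e. if R e then Some (H e) else None)}"
    proof (intro bind_pmf_cong refl arg_cong[where f = return_pmf] ext)
      fix H R' e assume "R' \<in> set_pmf (Pi_pmf ?X False (\<lambda>_. bernoulli_pmf a))"
      then show "(if e \<in> ?X then if R' e then Some (H e) else None else None) =
          (if R' e then Some (H e) else None)" by (metis R)
    qed
    finally show ?thesis
      by (simp add: map_pmf_def bind_assoc_pmf bind_return_pmf)
  qed
  then show ?thesis by (simp add: censored_hsbm_def)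
qed

lemma finite_labelings: "finite (labelings n)"
  by (auto simp: labelings_def)

lemma card_labelings: "card (labelings n) = 2 ^ n"
  by (simp add: labelings_def card_PiE_dflt numeral_2_eq_2)

lemma labelings_nonempty: "labelings n \<noteq> {}"
  using card_labelings[of n] by auto

lemma prior_eq: "prior n = pmf_of_set (labelings n)"
  unfolding prior_def labelings_def by (rule Pi_pmf_of_set) auto

lemma prob_censored_hsbm:
  "measure_pmf.prob (censored_hsbm m n p q a) E =
     (\<Sum>\<sigma>\<in>labelings n. measure_pmf.prob (obs_law m n p q a \<sigma>) {A. (\<sigma>, A) \<in> E}) / 2 ^ n"
proof -
  have "measure_pmf.prob (censored_hsbm m n p q a) E =
          measure_pmf.expectation (censored_hsbm m n p q a) (indicator E)" by simp
  also have "\<dots> = (\<Sum>\<sigma>\<in>labelings n. pmf (prior n) \<sigma> *\<^sub>R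
      measure_pmf.expectation (map_pmf (Pair \<sigma>) (obs_law m n p q a \<sigma>)) (indicator E))"
    unfolding censored_hsbm_eq
    by (rule pmf_expectation_bind)
      (auto simp: finite_labelings finite_set_obs_law prior_eq labelings_nonempty)
  also have "\<dots> = (\<Sum>\<sigma>\<in>labelings n. measure_pmf.prob (obs_law m n p q a \<sigma>) {A. (\<sigma>, A) \<in> E} / 2 ^ n)"
    by (intro sum.cong refl)
      (simp_all add: prior_eq labelings_nonempty finite_labelings card_labelings vimage_def)
  finally show ?thesis by (simp add: sum_divide_distrib)
qed

section \<open>Flipping one label in the hypergraph model\<close>

definition flip :: "nat \<Rightarrow> (nat \<Rightarrow> int) \<Rightarrow> nat \<Rightarrow> int" where
  "flip i \<sigma> = \<sigma>(i := - \<sigma> i)"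

lemma labelingsD: "\<sigma> \<in> labelings n \<Longrightarrow> j \<in> {1..n} \<Longrightarrow> \<sigma> j = 1 \<or> \<sigma> j = -1"
  unfolding labelings_def PiE_dflt_def by blast

lemma flip_in_labelings: "\<sigma> \<in> labelings n \<Longrightarrow> i \<in> {1..n} \<Longrightarrow> flip i \<sigma> \<in> labelings n"
  by (auto simp: labelings_def PiE_dflt_def flip_def)

lemma inj_on_flip: "\<sigma> \<in> labelings n \<Longrightarrow> inj_on (\<lambda>i. flip i \<sigma>) {1..n}"
  using labelingsD[of \<sigma> n] by (force simp: inj_on_def flip_def fun_eq_iff)

lemma edge_prob_eq:
  "e \<subseteq> {1..n} \<Longrightarrow>
     edge_prob n p q \<sigma> e = (if (\<forall>j\<in>e. \<sigma> j = 1) \<or> (\<forall>j\<in>e. \<sigma> j = -1) then p else q)"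
  by (auto simp: edge_prob_def I_plus_def I_minus_def subset_iff)

text \<open>Only hyperedges through \<open>i\<close> can change their probability. Those meeting
  \<open>S\<close> in further nodes are censored, with mass \<open>1 - a\<close> under both
  labelings, so the comparison reduces to the hyperedges that meet \<open>S\<close> in
  \<open>i\<close> alone.\<close>

lemma pmf_obs_law_flip_ge:
  fixes m n :: nat and S :: "nat set"
  assumes a: "a \<in> {0..1}" and p: "p \<in> {0<..<1}" and q: "q \<in> {0<..<1}"
  defines "X \<equiv> nsets {1..n} m"
  assumes prod: "(\<Prod>e | e \<in> X \<and> e \<inter> S = {i}. pmf (edge_law a (edge_prob n p q \<sigma> e)) (A e)) \<le>
                 (\<Prod>e | e \<in> X \<and> e \<inter> S = {i}. pmf (edge_law a (edge_prob n p q (flip i \<sigma>) e)) (A e))"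
    and none: "\<forall>e\<in>X. i \<in> e \<longrightarrow> e \<inter> S \<noteq> {i} \<longrightarrow> A e = None"
  shows "pmf (obs_law m n p q a \<sigma>) A \<le> pmf (obs_law m n p q a (flip i \<sigma>)) A"
proof (cases "\<forall>e. e \<notin> X \<longrightarrow> A e = None")
  case False
  then have "pmf (obs_law m n p q a \<sigma>) A = 0"
    unfolding obs_law_def X_def
    by (intro pmf_Pi_outside) (auto simp: finite_nsets_atLeastAtMost)
  then show ?thesis by simp
next
  case True
  have fin: "finite X" by (simp add: X_def finite_nsets_atLeastAtMost)
  define E where "E = {e \<in> X. e \<inter> S = {i}}"
  have E: "finite E" "E \<subseteq> X" using fin by (auto simp: E_def)
  have *: "pmf (obs_law m n p q a \<tau>) A =
          (\<Prod>e\<in>E. pmf (edge_law a (edge_prob n p q \<tau> e)) (A e)) *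
          (\<Prod>e\<in>X - E. pmf (edge_law a (edge_prob n p q \<tau> e)) (A e))" for \<tau>
    using True fin E unfolding obs_law_def X_def[symmetric]
    by (subst pmf_Pi') (auto simp: prod.subset_diff[OF E(2) fin])
  have same: "(\<Prod>e\<in>X - E. pmf (edge_law a (edge_prob n p q (flip i \<sigma>) e)) (A e)) =
        (\<Prod>e\<in>X - E. pmf (edge_law a (edge_prob n p q \<sigma> e)) (A e))"
  proof (rule prod.cong)
    fix e assume e: "e \<in> X - E"
    show "pmf (edge_law a (edge_prob n p q (flip i \<sigma>) e)) (A e) =
          pmf (edge_law a (edge_prob n p q \<sigma> e)) (A e)"
    proof (cases "i \<in> e")
      case True
      then have "A e = None" using none e by (auto simp: E_def)
      moreover have "edge_prob n p q \<tau> e \<in> {0..1}" for \<tau> using p q by (auto simp: edge_prob_def)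
      ultimately show ?thesis using a by (simp add: pmf_edge_law)
    next
      case False
      have "e \<subseteq> {1..n}" using e by (auto simp: X_def nsets_def)
      moreover have "flip i \<sigma> j = \<sigma> j" if "j \<in> e" for j using that False by (auto simp: flip_def)
      ultimately show ?thesis by (simp add: edge_prob_eq)
    qed
  qed simp
  show ?thesis unfolding * same
    using prod by (intro mult_right_mono) (auto simp: E_def prod_nonneg)
qed

text \<open>A hyperedge of \<open>E\<close> is affected by the flip exactly when its other
  \<open>m - 1\<close> nodes share a label \<open>s\<close>; there are \<open>c s\<close> of these.
  Cutting the larger family to the size of the smaller gives the situation of
  \<open>flip_prob_ge\<close>.\<close>

lemma flip_prob_ge_hsbm:
  fixes \<sigma> :: "nat \<Rightarrow> int" and S :: "nat set"
  assumes a: "a \<in> {0..1}" and p: "p \<in> {0<..<1}" and q: "q \<in> {0<..<1}" and m: "m \<ge> 2"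
    and \<sigma>: "\<sigma> \<in> labelings n" and S: "S \<subseteq> {1..n}" and i: "i \<in> S" and x: "x > 0"
  defines "c \<equiv> \<lambda>s. card {j \<in> {1..n} - S. \<sigma> j = s} choose (m - 1)"
  defines "E \<equiv> {e \<in> nsets {1..n} m. e \<inter> S = {i}}"
  shows "(1 - a * (1 - hellinger_affinity p q)) ^ (2 * min (c 1) (c (-1))) * exp (- x / 2) *
           ((1 - 2 * real (min (c 1) (c (-1))) * a * (llr_bound p q)\<^sup>2 / x\<^sup>2) / 2) *
           (1 - a) ^ (max (c 1) (c (-1)) - min (c 1) (c (-1))) \<le>
         measure_pmf.prob (obs_law m n p q a \<sigma>)
           {A. (\<Prod>e\<in>E. pmf (edge_law a (edge_prob n p q \<sigma> e)) (A e)) \<le>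
               (\<Prod>e\<in>E. pmf (edge_law a (edge_prob n p q (flip i \<sigma>) e)) (A e))}"
proof -
  define k where "k = min (c 1) (c (-1))"
  define C where "C s = {j \<in> {1..n} - S. \<sigma> j = s}" for s
  define P where "P s = insert i ` nsets (C s) (m - 1)" for s
  have iC: "i \<notin> C s" for s using i by (auto simp: C_def)
  have finC: "finite (C s)" for s by (simp add: C_def)
  have i_n: "i \<in> {1..n}" using S i by auto
  have cardP: "card (P s) = c s" for s
  proof -
    have "inj_on (insert i) (nsets (C s) (m - 1))"
      using iC[of s] by (auto simp: inj_on_def nsets_def)
    then show ?thesis
      by (simp add: P_def card_image c_def C_def)
  qed
  have finP: "finite (P s)" for s by (simp add: P_def finite_imp_finite_nsets finC)
  have PE: "P s \<subseteq> E" for s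
  proof
    fix e assume "e \<in> P s"
    then obtain e' where e': "e = insert i e'" "e' \<subseteq> C s" "finite e'" "card e' = m - 1"
      by (auto simp: P_def nsets_def)
    moreover have "i \<notin> e'" using e' iC by auto
    moreover have "e' \<inter> S = {}" "e' \<subseteq> {1..n}" using e' by (auto simp: C_def)
    ultimately show "e \<in> E" using m i i_n by (auto simp: E_def nsets_def)
  qed
  have Pmem: "e \<in> P s \<longleftrightarrow> (\<forall>j\<in>e - {i}. \<sigma> j = s)" if e: "e \<in> E" for e s
  proof
    assume "e \<in> P s"
    then show "\<forall>j\<in>e - {i}. \<sigma> j = s" by (auto simp: P_def nsets_def C_def)
  next
    assume *: "\<forall>j\<in>e - {i}. \<sigma> j = s"
    have "i \<in> e" using e by (auto simp: E_def)
    then have "e - {i} \<in> nsets (C s) (m - 1)" "e = insert i (e - {i})"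
      using e * by (auto simp: E_def nsets_def C_def)
    then show "e \<in> P s" unfolding P_def by blast
  qed
  \<comment> \<open>Because \<open>m \<ge> 2\<close>, a hyperedge has a node besides
    \<open>i\<close>. This keeps the condition in \<open>Pmem\<close> from holding for both labels
    at once.\<close>
  have ex: "\<exists>j. j \<in> e - {i}" if "e \<in> E" for e
  proof -
    have "i \<in> e" "card e = m" using that by (auto simp: E_def nsets_def)
    then have "card (e - {i}) = m - 1" by simp
    then have "e - {i} \<noteq> {}" using m by (metis One_nat_def Suc_1 Suc_le_eq card.empty diff_is_0_eq not_less_eq_eq lessI not_less)
    then show ?thesis by blast
  qed
  have Pdisj: "P 1 \<inter> P (-1) = {}"
  proof (rule equals0I)
    fix e assume e: "e \<in> P 1 \<inter> P (-1)"
    then have eE: "e \<in> E" using PE by blast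
    then obtain j where "j \<in> e - {i}" using ex by blast
    then show False using e Pmem[OF eE] by fastforce
  qed
  have \<sigma>i: "\<sigma> i = 1 \<or> \<sigma> i = -1" using labelingsD[OF \<sigma> i_n] .
  have eI: "e \<subseteq> {1..n}" "i \<in> e" if "e \<in> E" for e using that by (auto simp: E_def nsets_def)
  \<comment> \<open>A hyperedge of \<open>E\<close> lies inside one community before the flip iff
    its other nodes carry \<open>\<sigma> i\<close>, and after the flip iff they carry
    \<open>- \<sigma> i\<close>.\<close>
  have edge: "edge_prob n p q \<sigma> e = (if e \<in> P (\<sigma> i) then p else q)" if "e \<in> E" for e
    using \<sigma>i eI[OF that] by (auto simp: edge_prob_eq Pmem[OF that])
  have edge': "edge_prob n p q (flip i \<sigma>) e = (if e \<in> P (- \<sigma> i) then p else q)" if "e \<in> E" for e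
    using \<sigma>i eI[OF that] by (auto simp: edge_prob_eq Pmem[OF that] flip_def)
  have disj': "P (\<sigma> i) \<inter> P (- \<sigma> i) = {}" using \<sigma>i Pdisj by auto
  have cs: "k = min (c (\<sigma> i)) (c (- \<sigma> i))" "max (c 1) (c (-1)) = max (c (\<sigma> i)) (c (- \<sigma> i))"
    using \<sigma>i by (auto simp: k_def min.commute max.commute)
  obtain U where U: "U \<subseteq> P (\<sigma> i)" "card U = k"
    by (metis obtain_subset_with_card_n cs(1) min.cobounded1 cardP)
  obtain V where V: "V \<subseteq> P (- \<sigma> i)" "card V = k"
    by (metis obtain_subset_with_card_n cs(1) min.cobounded2 cardP)
  \<comment> \<open>One of the two differences is empty, since \<open>k\<close> is the size of the
    smaller family; hence \<open>W\<close> has the size maximum minus minimum.\<close>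
  define W where "W = (P (\<sigma> i) - U) \<union> (P (- \<sigma> i) - V)"
  have finUV: "finite U" "finite V" using U V finP finite_subset by blast+
  have "card W = card (P (\<sigma> i) - U) + card (P (- \<sigma> i) - V)"
    using disj' finP by (auto simp: W_def intro!: card_Un_disjoint)
  also have "\<dots> = (c (\<sigma> i) - k) + (c (- \<sigma> i) - k)"
    using U V finUV by (simp add: card_Diff_subset cardP)
  also have "\<dots> = max (c 1) (c (-1)) - k" unfolding cs by simp
  finally have cardW: "card W = max (c 1) (c (-1)) - k" .
  have finE: "finite E" by (simp add: E_def finite_nsets_atLeastAtMost)
  have EX: "E \<subseteq> nsets {1..n} m" by (auto simp: E_def)
  have "(1 - a * (1 - hellinger_affinity p q)) ^ (2 * card U) * exp (- x / 2) *
           ((1 - 2 * real (card U) * a * (llr_bound p q)\<^sup>2 / x\<^sup>2) / 2) * (1 - a) ^ card W \<le>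
        measure_pmf.prob (Pi_pmf E None (\<lambda>e. edge_law a (edge_prob n p q \<sigma> e)))
           {A. (\<Prod>e\<in>E. pmf (edge_law a (edge_prob n p q \<sigma> e)) (A e)) \<le>
               (\<Prod>e\<in>E. pmf (edge_law a (edge_prob n p q (flip i \<sigma>) e)) (A e))}"
  proof (rule flip_prob_ge[OF a p q finE _ _ _ _ _ _ _ x])
    show "U \<subseteq> E" "V \<subseteq> E" "W \<subseteq> E" using U V PE by (auto simp: W_def)
    show "U \<inter> V = {}" "U \<inter> W = {}" "V \<inter> W = {}" using U V disj' by (auto simp: W_def)
    show "card U = card V" using U V by simp
    show "edge_prob n p q \<sigma> e \<in> {0<..<1}" "edge_prob n p q (flip i \<sigma>) e \<in> {0<..<1}" for e
      using p q by (auto simp: edge_prob_def)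
    show "edge_prob n p q \<sigma> e = p \<and> edge_prob n p q (flip i \<sigma>) e = q" if "e \<in> U" for e
    proof -
      have "e \<in> E" "e \<in> P (\<sigma> i)" "e \<notin> P (- \<sigma> i)" using that U PE disj' by blast+
      then show ?thesis by (simp add: edge edge')
    qed
    show "edge_prob n p q \<sigma> e = q \<and> edge_prob n p q (flip i \<sigma>) e = p" if "e \<in> V" for e
    proof -
      have "e \<in> E" "e \<in> P (- \<sigma> i)" "e \<notin> P (\<sigma> i)" using that V PE disj' by blast+
      then show ?thesis by (simp add: edge edge')
    qed
    show "edge_prob n p q \<sigma> e = edge_prob n p q (flip i \<sigma>) e" if "e \<in> E" "e \<notin> U \<union> V \<union> W" for e
      using that edge[of e] edge'[of e] by (auto simp: W_def)
  qed
  also have "\<dots> = measure_pmf.prob (obs_law m n p q a \<sigma>)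
           {A. (\<Prod>e\<in>E. pmf (edge_law a (edge_prob n p q \<sigma> e)) (A e)) \<le>
               (\<Prod>e\<in>E. pmf (edge_law a (edge_prob n p q (flip i \<sigma>) e)) (A e))}"
    unfolding obs_law_def
    by (rule prob_Pi_pmf_subset[symmetric, OF finite_nsets_atLeastAtMost EX]) (auto cong: prod.cong)
  finally show ?thesis unfolding cardW U(2) k_def .
qed

text \<open>Such a hyperedge is determined by a second node \<open>j\<close> in \<open>S\<close> and
  its remaining \<open>m - 2\<close> nodes.\<close>

lemma card_edges_meeting_le:
  assumes "m \<ge> 2" "S \<subseteq> {1..n::nat}" "i \<in> S"
  shows "card {e \<in> nsets {1..n} m. i \<in> e \<and> e \<inter> S \<noteq> {i}} \<le> card S * n ^ (m - 2)"
proof -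
  have finS: "finite S" using assms finite_subset by blast
  have "{e \<in> nsets {1..n} m. i \<in> e \<and> e \<inter> S \<noteq> {i}} \<subseteq>
          (\<Union>j\<in>S. (\<lambda>e'. insert i (insert j e')) ` nsets {1..n} (m - 2))"
  proof (rule subsetI)
    fix e assume "e \<in> {e \<in> nsets {1..n} m. i \<in> e \<and> e \<inter> S \<noteq> {i}}"
    then have e: "e \<in> nsets {1..n} m" "i \<in> e" "e \<inter> S \<noteq> {i}" by auto
    then obtain j where j: "j \<in> e" "j \<in> S" "j \<noteq> i" using assms by blast
    have "e - {i, j} \<in> nsets {1..n} (m - 2)"
      using e j by (auto simp: nsets_def card_Diff_subset numeral_2_eq_2)
    moreover have "e = insert i (insert j (e - {i, j}))" using e j by auto
    ultimately show "e \<in> (\<Union>j\<in>S. (\<lambda>e'. insert i (insert j e')) ` nsets {1..n} (m - 2))"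
      using j by blast
  qed
  then have "card {e \<in> nsets {1..n} m. i \<in> e \<and> e \<inter> S \<noteq> {i}} \<le>
      card (\<Union>j\<in>S. (\<lambda>e'. insert i (insert j e')) ` nsets {1..n} (m - 2))"
    by (intro card_mono) (auto simp: finS finite_nsets_atLeastAtMost)
  also have "\<dots> \<le> (\<Sum>j\<in>S. card ((\<lambda>e'. insert i (insert j e')) ` nsets {1..n} (m - 2)))"
    by (rule card_UN_le[OF finS])
  also have "\<dots> \<le> (\<Sum>j\<in>S. n ^ (m - 2))"
  proof (intro sum_mono)
    fix j
    have "card ((\<lambda>e'. insert i (insert j e')) ` nsets {1..n} (m - 2)) \<le> card (nsets {1..n} (m - 2))"
      by (intro card_image_le finite_nsets_atLeastAtMost)
    also have "\<dots> = n choose (m - 2)" by simp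
    also have "\<dots> \<le> n ^ (m - 2)" by (cases "m - 2 \<le> n") (simp_all add: binomial_le_pow binomial_eq_0)
    finally show "card ((\<lambda>e'. insert i (insert j e')) ` nsets {1..n} (m - 2)) \<le> n ^ (m - 2)" .
  qed
  finally show ?thesis by simp
qed

text \<open>\<open>Gd i\<close> depends on the hyperedges \<open>E i\<close> only, and these are
  disjoint for different \<open>i\<close>, hence independence. The censoring events
  \<open>B i\<close> may share hyperedges, so only \<open>Gd i \<inter> B i\<close> with
  \<open>B i\<close> likely is available; \<open>prob_count_le_half_mean\<close> is made for
  this.\<close>

lemma prob_few_better_flips_le:
  fixes S :: "nat set"
  assumes a: "a \<in> {0..1}" and p: "p \<in> {0<..<1}" and q: "q \<in> {0<..<1}" and m: "m \<ge> 2"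
    and \<sigma>: "\<sigma> \<in> labelings n" and S: "S \<subseteq> {1..n}" "S \<noteq> {}"
    and g: "g > 0"
    and G: "\<And>i. i \<in> S \<Longrightarrow> g \<le> measure_pmf.prob (obs_law m n p q a \<sigma>)
        {A. (\<Prod>e | e \<in> nsets {1..n} m \<and> e \<inter> S = {i}. pmf (edge_law a (edge_prob n p q \<sigma> e)) (A e)) \<le>
            (\<Prod>e | e \<in> nsets {1..n} m \<and> e \<inter> S = {i}. pmf (edge_law a (edge_prob n p q (flip i \<sigma>) e)) (A e))}"
  shows "measure_pmf.prob (obs_law m n p q a \<sigma>)
           {A. real (card {\<tau> \<in> labelings n. pmf (obs_law m n p q a \<sigma>) A \<le> pmf (obs_law m n p q a \<tau>) A})
                 < real (card S) * g / 2} \<le>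
         4 / (real (card S) * g) + 8 * (a * (real (card S) * real n ^ (m - 2)))"
proof -
  define X where "X = nsets {1..n} m"
  define D where "D = obs_law m n p q a \<sigma>"
  define E where "E i = {e \<in> X. e \<inter> S = {i}}" for i
  define F where "F i = {e \<in> X. i \<in> e \<and> e \<inter> S \<noteq> {i}}" for i
  define Gd where "Gd i = {A. (\<Prod>e\<in>E i. pmf (edge_law a (edge_prob n p q \<sigma> e)) (A e)) \<le>
            (\<Prod>e\<in>E i. pmf (edge_law a (edge_prob n p q (flip i \<sigma>) e)) (A e))}" for i
  define B where "B i = {A :: observation. \<forall>e\<in>F i. A e = None}" for i
  define \<eta> where "\<eta> = a * (real (card S) * real n ^ (m - 2))"
  define \<mu> where "\<mu> = (\<Sum>i\<in>S. measure_pmf.prob D (Gd i))"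
  have finS: "finite S" using S finite_subset by blast
  have finX: "finite X" by (simp add: X_def finite_nsets_atLeastAtMost)
  have D: "D = Pi_pmf X None (\<lambda>e. edge_law a (edge_prob n p q \<sigma> e))"
    by (simp add: D_def obs_law_def X_def)
  have Gcong: "A \<in> Gd i \<longleftrightarrow> A' \<in> Gd i" if "\<And>e. e \<in> E i \<Longrightarrow> A e = A' e" for A A' i
    using that by (simp add: Gd_def cong: prod.cong)
  have Bcong: "A \<in> B i \<longleftrightarrow> A' \<in> B i" if "\<And>e. e \<in> F i \<Longrightarrow> A e = A' e" for A A' i
    using that by (simp add: B_def)
  have finD: "finite (set_pmf D)" by (simp add: D_def finite_set_obs_law)
  have ep: "edge_prob n p q \<sigma> e \<in> {0..1}" for e using p q by (auto simp: edge_prob_def)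
  have G_ge: "g \<le> measure_pmf.prob D (Gd i)" if "i \<in> S" for i
    using G[OF that] by (simp add: D_def Gd_def E_def X_def)
  have \<mu>_ge: "real (card S) * g \<le> \<mu>"
    using sum_mono[of S "\<lambda>_. g", OF G_ge] by (simp add: \<mu>_def)
  have pos: "0 < real (card S) * g" using finS S g by (simp add: card_gt_0_iff)
  have PB: "1 - \<eta> \<le> measure_pmf.prob D (B i)" if i: "i \<in> S" for i
  proof -
    have F: "F i \<subseteq> X" by (auto simp: F_def)
    have "real (card (F i)) \<le> real (card S * n ^ (m - 2))"
      unfolding of_nat_le_iff F_def X_def by (rule card_edges_meeting_le[OF m S(1) i])
    then have "a * real (card (F i)) \<le> \<eta>" unfolding \<eta>_def using a by (intro mult_left_mono) auto
    \<comment> \<open>Bernoulli's inequality plays the role of a union bound over the hyperedges in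
      \<open>F i\<close>.\<close>
    then have "1 - \<eta> \<le> 1 + real (card (F i)) * (- a)" by (simp add: mult.commute)
    also have "\<dots> \<le> (1 + (- a)) ^ card (F i)" using a by (intro Bernoulli_inequality) auto
    also have "\<dots> = measure_pmf.prob D (B i)"
      unfolding D B_def by (subst prob_None_Pi_edge_law[OF finX F a ep]) simp
    finally show ?thesis .
  qed
  have "measure_pmf.prob D {A. real (card {\<tau> \<in> labelings n. pmf D A \<le> pmf (obs_law m n p q a \<tau>) A})
                 < real (card S) * g / 2} \<le>
        measure_pmf.prob D {A. real (card {i\<in>S. A \<in> Gd i \<inter> B i}) \<le> \<mu> / 2}"
  proof (intro measure_pmf.finite_measure_mono Collect_mono impI)
    fix A assume A: "real (card {\<tau> \<in> labelings n. pmf D A \<le> pmf (obs_law m n p q a \<tau>) A})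
                 < real (card S) * g / 2"
    \<comment> \<open>Flips at different nodes are different labelings, so good indices can be
      counted in place of labelings.\<close>
    have "(\<lambda>i. flip i \<sigma>) ` {i\<in>S. A \<in> Gd i \<inter> B i} \<subseteq>
            {\<tau> \<in> labelings n. pmf D A \<le> pmf (obs_law m n p q a \<tau>) A}"
    proof safe
      fix i assume i: "i \<in> S" "A \<in> Gd i" "A \<in> B i"
      show "flip i \<sigma> \<in> labelings n" using \<sigma> S i by (intro flip_in_labelings) auto
      show "pmf D A \<le> pmf (obs_law m n p q a (flip i \<sigma>)) A" unfolding D_def
        by (rule pmf_obs_law_flip_ge[OF a p q, where S = S])
          (use i in \<open>auto simp: Gd_def E_def X_def B_def F_def\<close>)
    qed
    then have "card ((\<lambda>i. flip i \<sigma>) ` {i\<in>S. A \<in> Gd i \<inter> B i}) \<le>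
        card {\<tau> \<in> labelings n. pmf D A \<le> pmf (obs_law m n p q a \<tau>) A}"
      by (intro card_mono) (auto simp: finite_labelings)
    moreover have "card ((\<lambda>i. flip i \<sigma>) ` {i\<in>S. A \<in> Gd i \<inter> B i}) = card {i\<in>S. A \<in> Gd i \<inter> B i}"
      using S by (intro card_image inj_on_subset[OF inj_on_flip[OF \<sigma>]]) auto
    ultimately show "real (card {i\<in>S. A \<in> Gd i \<inter> B i}) \<le> \<mu> / 2"
      using A \<mu>_ge by simp
  qed auto
  also have "\<dots> \<le> 4 / \<mu> + 8 * \<eta>"
    unfolding \<mu>_def
  proof (rule prob_count_le_half_mean[OF finD finS])
    show "Gd i \<inter> B i \<subseteq> Gd i" for i by auto
    show "(1 - \<eta>) * measure_pmf.prob D (Gd i) \<le> measure_pmf.prob D (Gd i \<inter> B i)" if i: "i \<in> S" for i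
    proof -
      have "measure_pmf.prob D (Gd i \<inter> B i) = measure_pmf.prob D (Gd i) * measure_pmf.prob D (B i)"
        unfolding D
      proof (rule prob_Int_Pi_pmf[where J = "E i" and K = "F i"])
        show "E i \<inter> F i = {}" "E i \<subseteq> X" "F i \<subseteq> X" by (auto simp: E_def F_def)
      qed (fact Gcong Bcong finX | simp)+
      then show ?thesis using mult_right_mono[OF PB[OF i], of "measure_pmf.prob D (Gd i)"]
        by (simp add: mult.commute)
    qed
    show "measure_pmf.prob D (Gd i \<inter> Gd j) \<le> measure_pmf.prob D (Gd i) * measure_pmf.prob D (Gd j)"
      if "i \<in> S" "j \<in> S" "i \<noteq> j" for i j
      unfolding D
    proof (rule eq_refl, rule prob_Int_Pi_pmf[where J = "E i" and K = "E j"])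
      show "E i \<inter> E j = {}" "E i \<subseteq> X" "E j \<subseteq> X" using that by (auto simp: E_def)
    qed (fact Gcong finX | simp)+
    show "0 < (\<Sum>i\<in>S. measure_pmf.prob D (Gd i))"
      using \<mu>_ge pos by (simp add: \<mu>_def)
  qed
  also have "4 / \<mu> \<le> 4 / (real (card S) * g)"
    using \<mu>_ge pos by (intro frac_le) auto
  finally show ?thesis by (simp add: D_def \<eta>_def)
qed

section \<open>Asymptotics\<close>

text \<open>\<open>B\<close> collects the labelings for which single flips are understood; all
  others are counted as successes. With \<open>K = real (card S) * g\<close>, the constant 6 is 4
  from the event of too few competitors plus 2 from \<open>sum_prob_est_le\<close> at level
  \<open>K / 2\<close>.\<close>

lemma success_prob_le:
  fixes S :: "nat set" and est :: "observation \<Rightarrow> nat \<Rightarrow> int"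
  assumes a: "a \<in> {0..1}" and p: "p \<in> {0<..<1}" and q: "q \<in> {0<..<1}" and m: "m \<ge> 2"
    and S: "S \<subseteq> {1..n}" "S \<noteq> {}" and g: "g > 0" and B: "B \<subseteq> labelings n"
    and G: "\<And>\<sigma> i. \<sigma> \<in> B \<Longrightarrow> i \<in> S \<Longrightarrow> g \<le> measure_pmf.prob (obs_law m n p q a \<sigma>)
        {A. (\<Prod>e | e \<in> nsets {1..n} m \<and> e \<inter> S = {i}. pmf (edge_law a (edge_prob n p q \<sigma> e)) (A e)) \<le>
            (\<Prod>e | e \<in> nsets {1..n} m \<and> e \<inter> S = {i}. pmf (edge_law a (edge_prob n p q (flip i \<sigma>) e)) (A e))}"
  shows "measure_pmf.prob (censored_hsbm m n p q a) {(\<sigma>, A). est A = \<sigma>} \<le>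
           real (card (labelings n - B)) / 2 ^ n +
           6 / (real (card S) * g) + 8 * (a * (real (card S) * real n ^ (m - 2)))"
proof -
  define K where "K = real (card S) * g"
  define \<eta> where "\<eta> = a * (real (card S) * real n ^ (m - 2))"
  define D where "D = obs_law m n p q a"
  define many where
    "many \<sigma> = {A. K / 2 \<le> real (card {\<tau> \<in> labelings n. pmf (D \<sigma>) A \<le> pmf (D \<tau>) A})}" for \<sigma>
  have finS: "finite S" using S finite_subset by blast
  have K: "K > 0" using finS S g by (simp add: K_def card_gt_0_iff)
  have \<eta>: "\<eta> \<ge> 0" using a by (simp add: \<eta>_def)
  have bound: "measure_pmf.prob (D \<sigma>) {A. est A = \<sigma>} \<le>
      (if \<sigma> \<in> B then 4 / K + 8 * \<eta> else 1) + measure_pmf.prob (D \<sigma>) {A. est A = \<sigma> \<and> A \<in> many \<sigma>}"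
    if \<sigma>: "\<sigma> \<in> labelings n" for \<sigma>
  proof (cases "\<sigma> \<in> B")
    case True
    have "measure_pmf.prob (D \<sigma>) {A. est A = \<sigma>} \<le>
            measure_pmf.prob (D \<sigma>) (- many \<sigma> \<union> {A. est A = \<sigma> \<and> A \<in> many \<sigma>})"
      by (intro measure_pmf.finite_measure_mono) auto
    also have "\<dots> \<le> measure_pmf.prob (D \<sigma>) (- many \<sigma>) + measure_pmf.prob (D \<sigma>) {A. est A = \<sigma> \<and> A \<in> many \<sigma>}"
      by (intro measure_Un_le) auto
    also have "- many \<sigma> = {A. real (card {\<tau> \<in> labelings n. pmf (D \<sigma>) A \<le> pmf (D \<tau>) A}) < K / 2}"
      by (auto simp: many_def)
    also have "measure_pmf.prob (D \<sigma>) \<dots> \<le> 4 / K + 8 * \<eta>"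
      unfolding D_def K_def \<eta>_def by (rule prob_few_better_flips_le[OF a p q m \<sigma> S g G[OF True]])
    finally show ?thesis using True by simp
  next
    case False
    then show ?thesis by (simp add: add_increasing2)
  qed
  have "measure_pmf.prob (censored_hsbm m n p q a) {(\<sigma>, A). est A = \<sigma>} =
          (\<Sum>\<sigma>\<in>labelings n. measure_pmf.prob (D \<sigma>) {A. est A = \<sigma>}) / 2 ^ n"
    by (simp add: prob_censored_hsbm D_def)
  also have "\<dots> \<le> ((\<Sum>\<sigma>\<in>labelings n. if \<sigma> \<in> B then 4 / K + 8 * \<eta> else 1) +
                (\<Sum>\<sigma>\<in>labelings n. measure_pmf.prob (D \<sigma>) {A. est A = \<sigma> \<and> A \<in> many \<sigma>})) / 2 ^ n"
    unfolding sum.distrib[symmetric] by (intro divide_right_mono sum_mono bound) auto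
  also have "(\<Sum>\<sigma>\<in>labelings n. measure_pmf.prob (D \<sigma>) {A. est A = \<sigma> \<and> A \<in> many \<sigma>}) \<le>
               real (card (labelings n)) / (K / 2)"
    unfolding many_def mem_Collect_eq using K
    by (intro sum_prob_est_le) (auto simp: finite_labelings D_def finite_set_obs_law)
  also have "(\<Sum>\<sigma>\<in>labelings n. if \<sigma> \<in> B then 4 / K + 8 * \<eta> else 1) =
               real (card B) * (4 / K + 8 * \<eta>) + real (card (labelings n - B))"
    using B by (simp add: sum.If_cases finite_labelings Int_absorb1 set_diff_eq[symmetric] Diff_eq)
  also have "real (card B) \<le> 2 ^ n"
    using card_mono[OF finite_labelings B] by (simp add: card_labelings)
  finally have "measure_pmf.prob (censored_hsbm m n p q a) {(\<sigma>, A). est A = \<sigma>} \<le>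
     (2 ^ n * (4 / K + 8 * \<eta>) + real (card (labelings n - B)) + 2 ^ n / (K / 2)) / 2 ^ n"
    using K \<eta> by (simp add: card_labelings mult_right_mono divide_right_mono)
  also have "\<dots> = real (card (labelings n - B)) / 2 ^ n + 6 / K + 8 * \<eta>"
    using K by (simp add: field_simps)
  finally show ?thesis by (simp add: K_def \<eta>_def)
qed

section \<open>Balance of a random labeling and elementary estimates\<close>

lemma unbalanced_labelings_le:
  assumes "n > 0" "\<epsilon> > 0"
  shows "real (card {\<sigma> \<in> labelings n. \<epsilon> * real n \<le> \<bar>\<Sum>j\<in>{1..n}. real_of_int (\<sigma> j)\<bar>}) / 2 ^ n \<le>
           1 / (\<epsilon>\<^sup>2 * real n)"
proof -
  have E: "measure_pmf.expectation (pmf_of_set {1, -1 :: int}) real_of_int = 0"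
    "measure_pmf.expectation (pmf_of_set {1, -1 :: int}) (\<lambda>y. (real_of_int y)\<^sup>2) = 1"
    by (simp_all add: integral_pmf_of_set)
  have "real (card {\<sigma> \<in> labelings n. \<epsilon> * real n \<le> \<bar>\<Sum>j\<in>{1..n}. real_of_int (\<sigma> j)\<bar>}) / 2 ^ n =
          measure_pmf.prob (prior n) {\<sigma>. \<epsilon> * real n \<le> \<bar>\<Sum>j\<in>{1..n}. real_of_int (\<sigma> j)\<bar>}"
    by (simp add: prior_eq measure_pmf_of_set labelings_nonempty finite_labelings card_labelings Int_def)
  also have "\<dots> \<le> measure_pmf.expectation (prior n) (\<lambda>\<sigma>. (\<Sum>j\<in>{1..n}. real_of_int (\<sigma> j))\<^sup>2) / (\<epsilon> * real n)\<^sup>2"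
    using assms by (intro Chebyshev_pmf) (auto simp: prior_eq labelings_nonempty finite_labelings)
  \<comment> \<open>Under the prior the labels are independent centred signs, so their sum has
    second moment at most \<open>n\<close>.\<close>
  also have "measure_pmf.expectation (prior n) (\<lambda>\<sigma>. (\<Sum>j\<in>{1..n}. real_of_int (\<sigma> j))\<^sup>2) \<le> (\<Sum>j\<in>{1..n}. 1)"
    unfolding prior_def E(2)[symmetric] by (rule second_moment_sum_Pi_pmf) (auto simp: E)
  also have "(\<Sum>j\<in>{1..n}. 1) / (\<epsilon> * real n)\<^sup>2 = 1 / (\<epsilon>\<^sup>2 * real n)"
    using assms by (simp add: field_simps power2_eq_square)
  finally show ?thesis by (simp add: divide_right_mono)
qed

text \<open>Pascal's rule is applied \<open>d\<close> times, each application adding at most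
  \<open>(x + d) ^ k\<close>.\<close>

lemma binomial_diff_le: "(x + d) choose Suc k \<le> (x choose Suc k) + d * (x + d) ^ k"
proof (induction d)
  case (Suc d)
  have "(x + d) choose k \<le> (x + d) ^ k"
    by (cases "k \<le> x + d") (simp_all add: binomial_le_pow binomial_eq_0)
  moreover have "(x + d) ^ k \<le> (x + Suc d) ^ k" by (intro power_mono) auto
  moreover have "d * (x + d) ^ k \<le> d * (x + Suc d) ^ k" by (intro mult_left_mono power_mono) auto
  ultimately show ?case
    using Suc unfolding add_Suc_right binomial_Suc_Suc mult_Suc by linarith
qed simp

text \<open>With \<open>k = m - 2\<close> this controls the surplus family for community sizes that
  differ by at most \<open>d\<close>.\<close>

lemma binomial_max_diff_min_le:
  fixes x y n d k :: nat
  assumes "x \<le> n" "y \<le> n" "x \<le> y + d" "y \<le> x + d"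
  shows "max (x choose Suc k) (y choose Suc k) - min (x choose Suc k) (y choose Suc k) \<le> d * n ^ k"
proof -
  have *: "(v choose Suc k) - (u choose Suc k) \<le> d * n ^ k" if "u \<le> v" "v \<le> u + d" "v \<le> n" for u v
  proof -
    have "(v choose Suc k) \<le> (u choose Suc k) + (v - u) * v ^ k"
      using binomial_diff_le[of u "v - u" k] that by simp
    also have "\<dots> \<le> (u choose Suc k) + d * n ^ k"
      using that by (intro add_left_mono mult_mono power_mono) auto
    finally show ?thesis by simp
  qed
  show ?thesis
  proof (cases "x \<le> y")
    case True
    then have "(x choose Suc k) \<le> (y choose Suc k)" by (rule binomial_right_mono)
    with *[of x y] True assms show ?thesis by simp
  next
    case False
    then have "(y choose Suc k) \<le> (x choose Suc k)" by (intro binomial_right_mono) simp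
    with *[of y x] False assms show ?thesis by simp
  qed
qed

lemma binomial_le_power_div_fact: "real (x choose k) \<le> real x ^ k / fact k"
proof -
  have "real ((x choose k) * fact k) \<le> real (x ^ k)"
    unfolding of_nat_le_iff by (rule binomial_fact_pow)
  then show ?thesis by (simp add: field_simps)
qed

text \<open>For \<open>y \<le> 1 / 2\<close> one has
  \<open>ln (1 - y) \<ge> - y - 2 * y\<^sup>2\<close>, and \<open>2 * y \<le> \<delta>\<close>
  absorbs the quadratic term into the factor \<open>1 + \<delta>\<close>.\<close>

lemma power_one_minus_ge_exp:
  fixes y c :: real
  assumes "0 \<le> y" "y \<le> 1 / 2" "2 * y \<le> \<delta>" "real k * y \<le> c"
  shows "exp (- ((1 + \<delta>) * c)) \<le> (1 - y) ^ k"
proof -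
  have "(1 + \<delta>) * (real k * y) \<le> (1 + \<delta>) * c" using assms by (intro mult_left_mono) auto
  moreover have "real k * (- y - 2 * y\<^sup>2) \<ge> real k * (- ((1 + \<delta>) * y))"
  proof (rule mult_left_mono)
    have "y * (2 * y) \<le> y * \<delta>" using assms by (intro mult_left_mono) auto
    then show "- ((1 + \<delta>) * y) \<le> - y - 2 * y\<^sup>2" by (simp add: algebra_simps power2_eq_square)
  qed simp
  moreover have "real k * (- y - 2 * y\<^sup>2) \<le> real k * ln (1 - y)"
    using assms by (intro mult_left_mono ln_one_minus_pos_lower_bound) auto
  ultimately have "- ((1 + \<delta>) * c) \<le> real k * ln (1 - y)" by (simp add: algebra_simps)
  then have "exp (- ((1 + \<delta>) * c)) \<le> exp (real k * ln (1 - y))" by simp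
  also have "\<dots> = (1 - y) ^ k" using assms by (simp add: exp_of_nat_mult)
  finally show ?thesis .
qed

text \<open>\<open>\<tau>\<close> is \<open>t\<close> divided by the recovery threshold, with the
  affinity in place of the squared differences. In the exponent,
  \<open>(1 + \<epsilon>) * \<tau>\<close> comes from the tilt, \<open>\<epsilon>\<close> from the
  window \<open>x\<close>, and \<open>4 * \<epsilon> * t\<close> from censoring the surplus.\<close>

lemma flip_prob_ge_powr:
  fixes S :: "nat set" and p q t \<epsilon> :: real
  assumes p: "p \<in> {0<..<1}" and q: "q \<in> {0<..<1}" and m: "m \<ge> 2" and t: "t > 0" and \<epsilon>: "\<epsilon> > 0"
    and \<sigma>: "\<sigma> \<in> labelings n" and S: "S \<subseteq> {1..n}" and i: "i \<in> S" and n: "n \<ge> 2"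
    and cardS: "real (card S) \<le> \<epsilon> * real n"
    and bal: "\<bar>\<Sum>j\<in>{1..n}. real_of_int (\<sigma> j)\<bar> < \<epsilon> * real n"
  defines "a \<equiv> t * ln (real n) / real n ^ (m - 1)"
    and "\<tau> \<equiv> 2 * t * (1 - hellinger_affinity p q) / (2 ^ (m - 1) * fact (m - 1))"
  assumes a: "a \<le> 1 / 2" "2 * a \<le> \<epsilon>" and large: "t * (llr_bound p q)\<^sup>2 \<le> \<epsilon>\<^sup>2 * ln (real n)"
  shows "real n powr (- ((1 + \<epsilon>) * \<tau> + \<epsilon> + 4 * \<epsilon> * t)) / 4 \<le>
         measure_pmf.prob (obs_law m n p q a \<sigma>)
        {A. (\<Prod>e | e \<in> nsets {1..n} m \<and> e \<inter> S = {i}. pmf (edge_law a (edge_prob n p q \<sigma> e)) (A e)) \<le>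
            (\<Prod>e | e \<in> nsets {1..n} m \<and> e \<inter> S = {i}. pmf (edge_law a (edge_prob n p q (flip i \<sigma>) e)) (A e))}"
proof -
  define h where "h = hellinger_affinity p q"
  define N where "N s = card {j \<in> {1..n} - S. \<sigma> j = s}" for s
  define k where "k = min (N 1 choose (m - 1)) (N (-1) choose (m - 1))"
  define w where "w = max (N 1 choose (m - 1)) (N (-1) choose (m - 1)) - k"
  \<comment> \<open>The window costs \<open>exp (- x / 2) = n powr (- \<epsilon>)\<close>, while
    \<open>x\<^sup>2\<close>, of order \<open>(ln n)\<^sup>2\<close>, eventually dominates the
    variance of order \<open>ln n\<close>.\<close>
  define x where "x = 2 * \<epsilon> * ln (real n)"
  define c where "c = llr_bound p q"
  have h: "0 < h" "h \<le> 1" using hellinger_affinity_bounds[OF p q] by (simp_all add: h_def)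
  have ln: "ln (real n) > 0" using n by simp
  have x: "x > 0" using \<epsilon> ln by (simp add: x_def)
  have a0: "a \<ge> 0" using t ln by (simp add: a_def)
  have npos: "real n > 0" using n by simp
  have finS: "finite S" using S finite_subset by blast
  have an: "a * real n ^ (m - 1) = t * ln (real n)" using npos by (simp add: a_def)
  have N_sum: "N 1 + N (-1) = n - card S"
  proof -
    have eq: "{1..n} - S = {j \<in> {1..n} - S. \<sigma> j = 1} \<union> {j \<in> {1..n} - S. \<sigma> j = -1}"
      using labelingsD[OF \<sigma>] by (intro equalityI subsetI) (simp_all, metis)
    have "card ({1..n} - S) = N 1 + N (-1)"
      unfolding N_def by (subst eq, rule card_Un_disjoint) auto
    then show ?thesis using S finS by (simp add: card_Diff_subset)
  qed
  \<comment> \<open>One \<open>\<epsilon> * real n\<close> is the imbalance of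
    \<open>\<sigma>\<close>, the other the effect of removing \<open>S\<close>.\<close>
  have N_diff: "\<bar>real (N 1) - real (N (-1))\<bar> \<le> 2 * \<epsilon> * real n"
  proof -
    have "(\<Sum>j\<in>{1..n} - S. real_of_int (\<sigma> j)) =
            (\<Sum>j\<in>{1..n} - S. (if \<sigma> j = 1 then 1 else 0) - (if \<sigma> j = -1 then 1 else 0))"
      using labelingsD[OF \<sigma>] by (intro sum.cong) auto
    also have "\<dots> = real (N 1) - real (N (-1))"
      by (simp add: sum_subtractf N_def sum.If_cases Int_def)
    finally have "real (N 1) - real (N (-1)) = (\<Sum>j\<in>{1..n}. real_of_int (\<sigma> j)) - (\<Sum>j\<in>S. real_of_int (\<sigma> j))"
      using S by (simp add: sum_diff)
    moreover have "\<bar>\<Sum>j\<in>S. real_of_int (\<sigma> j)\<bar> \<le> (\<Sum>j\<in>S. 1)"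
    proof (intro order_trans[OF sum_abs] sum_mono)
      fix j assume "j \<in> S"
      then have "j \<in> {1..n}" using S by blast
      then show "\<bar>real_of_int (\<sigma> j)\<bar> \<le> 1" using labelingsD[OF \<sigma>, of j] by auto
    qed
    ultimately show ?thesis using bal cardS by simp
  qed
  define M where "M = min (N 1) (N (-1))"
  have k_eq: "k = M choose (m - 1)"
    unfolding k_def M_def
    by (rule min_of_mono) (intro monoI binomial_right_mono)
  \<comment> \<open>The smaller community has at most half of the nodes. This is the origin of
    \<open>2 ^ (m - 1) * fact (m - 1)\<close> in the threshold.\<close>
  have "real M \<le> real n / 2" using N_sum by (auto simp: M_def)
  then have "real M ^ (m - 1) \<le> (real n / 2) ^ (m - 1)" by (intro power_mono) auto
  then have "real k \<le> (real n / 2) ^ (m - 1) / fact (m - 1)"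
    unfolding k_eq by (intro order_trans[OF binomial_le_power_div_fact] divide_right_mono) auto
  then have k: "real k \<le> real n ^ (m - 1) / (2 ^ (m - 1) * fact (m - 1))"
    by (simp add: power_divide)
  have ka: "2 * real k * a \<le> 2 * t * ln (real n) / (2 ^ (m - 1) * fact (m - 1))"
    using mult_right_mono[OF k a0] an by (simp add: field_simps)
  have kah: "real (2 * k) * (a * (1 - h)) \<le> \<tau> * ln (real n)"
  proof -
    have "real (2 * k) * (a * (1 - h)) = 2 * real k * a * (1 - h)" by simp
    also have "\<dots> \<le> 2 * t * ln (real n) / (2 ^ (m - 1) * fact (m - 1)) * (1 - h)"
      using h by (intro mult_right_mono ka) simp
    also have "\<dots> = \<tau> * ln (real n)"
      unfolding \<tau>_def h_def by (simp only: times_divide_eq_left times_divide_eq_right mult_ac)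
    finally show ?thesis .
  qed
  have "fact (m - 1) * 2 ^ (m - 1) \<ge> (1 * 1 :: real)" by (intro mult_mono) auto
  then have "2 * t * ln (real n) / (2 ^ (m - 1) * fact (m - 1)) \<le> 2 * t * ln (real n) / 1"
    using t ln by (intro divide_left_mono) (auto simp: mult.commute)
  with ka have ka': "2 * real k * a \<le> 2 * t * ln (real n)" by simp
  have "2 * real k * a * c\<^sup>2 \<le> 2 * t * ln (real n) * c\<^sup>2" by (intro mult_right_mono ka') simp
  also have "\<dots> = 2 * ln (real n) * (t * c\<^sup>2)" by simp
  also have "\<dots> \<le> 2 * ln (real n) * (\<epsilon>\<^sup>2 * ln (real n))"
    using large ln by (intro mult_left_mono) (auto simp: c_def)
  also have "\<dots> = x\<^sup>2 / 2" by (simp add: x_def power2_eq_square)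
  finally have var: "(1 - 2 * real k * a * c\<^sup>2 / x\<^sup>2) / 2 \<ge> 1 / 4" using x by (simp add: field_simps)
  have ah: "a * (1 - h) \<le> a" using a0 h by (simp add: mult_left_le)
  have 1: "exp (- ((1 + \<epsilon>) * (\<tau> * ln (real n)))) \<le> (1 - a * (1 - h)) ^ (2 * k)"
    using a a0 h ah kah by (intro power_one_minus_ge_exp) auto
  define m' where "m' = m - 2"
  have m': "m - 1 = Suc m'" using m unfolding m'_def by linarith
  define d where "d = max (N 1) (N (-1)) - min (N 1) (N (-1))"
  have d: "real d \<le> 2 * \<epsilon> * real n" using N_diff unfolding d_def by (cases "N 1 \<le> N (-1)") auto
  have "w \<le> d * n ^ m'"
    unfolding w_def k_def m' using N_sum by (intro binomial_max_diff_min_le) (auto simp: d_def)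
  then have "real w \<le> real d * real n ^ m'" by (metis of_nat_le_iff of_nat_mult of_nat_power)
  also have "\<dots> \<le> 2 * \<epsilon> * real n * real n ^ m'" by (intro mult_right_mono d) auto
  finally have "real w * a \<le> 2 * \<epsilon> * real n * real n ^ m' * a" using a0 by (intro mult_right_mono) auto
  also have "\<dots> = 2 * \<epsilon> * (a * real n ^ (m - 1))" unfolding m' by simp
  finally have wa: "real w * a \<le> 2 * \<epsilon> * t * ln (real n)" unfolding an by (simp only: mult.assoc)
  \<comment> \<open>Here \<open>\<delta> = 1\<close> is accurate enough, because the surplus already
    contributes only order \<open>\<epsilon>\<close> to the exponent.\<close>
  have 2: "exp (- ((1 + 1) * (2 * \<epsilon> * t * ln (real n)))) \<le> (1 - a) ^ w"
    using a a0 wa by (intro power_one_minus_ge_exp) auto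
  have "real n powr (- ((1 + \<epsilon>) * \<tau> + \<epsilon> + 4 * \<epsilon> * t)) / 4 =
      exp (- ((1 + \<epsilon>) * (\<tau> * ln (real n)))) * exp (- x / 2) * (1 / 4) *
      exp (- ((1 + 1) * (2 * \<epsilon> * t * ln (real n))))"
    using npos by (simp add: powr_def x_def algebra_simps flip: exp_add)
  also have "\<dots> \<le> (1 - a * (1 - h)) ^ (2 * k) * exp (- x / 2) *
           ((1 - 2 * real k * a * c\<^sup>2 / x\<^sup>2) / 2) * (1 - a) ^ w"
  proof -
    have nonneg: "0 \<le> (1 - a * (1 - h)) ^ (2 * k)" "0 \<le> (1 - 2 * real k * a * c\<^sup>2 / x\<^sup>2) / 2"
      using a a0 ah var by (auto intro: zero_le_power)
    show ?thesis by (intro mult_mono 1 2 var order_refl mult_nonneg_nonneg nonneg exp_ge_zero) simp_all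
  qed
  also have "\<dots> \<le> measure_pmf.prob (obs_law m n p q a \<sigma>)
        {A. (\<Prod>e | e \<in> nsets {1..n} m \<and> e \<inter> S = {i}. pmf (edge_law a (edge_prob n p q \<sigma> e)) (A e)) \<le>
            (\<Prod>e | e \<in> nsets {1..n} m \<and> e \<inter> S = {i}. pmf (edge_law a (edge_prob n p q (flip i \<sigma>) e)) (A e))}"
    unfolding w_def k_def N_def h_def c_def
    by (rule flip_prob_ge_hsbm[OF _ p q m \<sigma> S i x]) (use a a0 in auto)
  finally show ?thesis .
qed

section \<open>Choice of the parameters and passage to the limit\<close>

theorem theorem2p1:
  fixes m :: nat and p q t :: real
    and est :: "nat \<Rightarrow> observation \<Rightarrow> (nat \<Rightarrow> int)"
  assumes "m \<ge> 2"
    and "0 < p" and "p < 1" and "0 < q" and "q < 1" and "p > q"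
    and "t > 0"
    and "t < recovery_threshold m p q"
    and "\<And>n. est n \<in> observations m n \<rightarrow> labelings n"
  shows "(\<lambda>n. measure_pmf.prob
             (censored_hsbm m n p q (t * ln (real n) / real n ^ (m - 1)))
             {(\<sigma>, A). est n A = \<sigma>}) \<longlonglongrightarrow> 0"
proof -
  have p: "p \<in> {0<..<1}" and q: "q \<in> {0<..<1}" using assms by auto
  note m = \<open>m \<ge> 2\<close> and t = \<open>t > 0\<close>
  define h where "h = hellinger_affinity p q"
  define \<tau> where "\<tau> = 2 * t * (1 - h) / (2 ^ (m - 1) * fact (m - 1))"
  define a where "a n = t * ln (real n) / real n ^ (m - 1)" for n
  have h: "0 < h" "h \<le> 1" using hellinger_affinity_bounds[OF p q] by (simp_all add: h_def)
  have thr: "t < 2 ^ (m - 1) * fact (m - 1) / (2 * (1 - h))"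
    using assms(8) by (simp add: recovery_threshold_def hellinger_affinity_eq[OF p q] h_def)
  \<comment> \<open>For \<open>h = 1\<close> the right side of \<open>thr\<close> is a division by
    zero, hence 0, against \<open>t > 0\<close>.\<close>
  have "h \<noteq> 1" using thr t by auto
  with h have h1: "1 - h > 0" by simp
  have \<tau>: "0 < \<tau>" "\<tau> < 1" using thr t h1 by (simp_all add: \<tau>_def field_simps)
  \<comment> \<open>The expected number of good flips is at least of order
    \<open>n powr (1 - \<epsilon>)\<close> times the bound of \<open>flip_prob_ge_powr\<close>,
    whose total exponent is \<open>1 - \<tau> - \<epsilon> * (\<tau> + 2 + 4 * t)\<close>. This
    \<open>\<epsilon>\<close> spends half of the gap \<open>1 - \<tau>\<close> and leaves the other
    half as \<open>\<theta>\<close>.\<close>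
  define \<epsilon> where "\<epsilon> = (1 - \<tau>) / (2 * (\<tau> + 2 + 4 * t))"
  define \<theta> where "\<theta> = (1 - \<tau>) / 2"
  have \<epsilon>: "\<epsilon> > 0" using \<tau> t by (simp add: \<epsilon>_def)
  have "\<epsilon> * (\<tau> + 2 + 4 * t) = (1 - \<tau>) / 2" using \<tau> t by (simp add: \<epsilon>_def field_simps)
  then have \<theta>_eq: "1 - \<epsilon> + - ((1 + \<epsilon>) * \<tau> + \<epsilon> + 4 * \<epsilon> * t) = \<theta>"
    by (simp add: \<theta>_def algebra_simps)
  have \<theta>: "\<theta> > 0" using \<tau> by (simp add: \<theta>_def)
  define s where "s n = nat \<lfloor>real n powr (1 - \<epsilon>)\<rfloor>" for n
  define g where "g n = real n powr (- ((1 + \<epsilon>) * \<tau> + \<epsilon> + 4 * \<epsilon> * t)) / 4" for n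
  \<comment> \<open>The three terms bound the unbalanced labelings, the reciprocal of the expected
    number of good flips, and the chance of a revealed hyperedge through \<open>i\<close> with
    further nodes in \<open>S\<close>.\<close>
  define bd where "bd n = 1 / (\<epsilon>\<^sup>2 * real n) + 6 / (real n powr \<theta> / 8) +
      8 * (t * ln (real n) * real n powr (- \<epsilon>))" for n :: nat
  have \<epsilon>1: "\<epsilon> < 1"
  proof -
    have "0 < 3 * \<tau> + 3 + 8 * t" using \<tau> t by (intro add_pos_pos) auto
    then have "1 - \<tau> < 2 * (\<tau> + 2 + 4 * t)" by (simp add: distrib_left)
    then show ?thesis using \<tau> t by (simp add: \<epsilon>_def)
  qed
  have ev1: "eventually (\<lambda>n. t * ln (real n) / real n \<le> min (1 / 2) (\<epsilon> / 2)) sequentially"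
  proof -
    have "(\<lambda>n. t * ln (real n) / real n) \<longlonglongrightarrow> 0" by real_asymp
    then have "eventually (\<lambda>n. t * ln (real n) / real n < min (1 / 2) (\<epsilon> / 2)) sequentially"
      by (rule order_tendstoD) (use \<epsilon> in auto)
    then show ?thesis by eventually_elim simp
  qed
  have ev2: "eventually (\<lambda>n. t * (llr_bound p q)\<^sup>2 \<le> \<epsilon>\<^sup>2 * ln (real n)) sequentially"
  proof -
    have "filterlim (\<lambda>n. \<epsilon>\<^sup>2 * ln (real n)) at_top sequentially" using \<epsilon> by real_asymp
    then show ?thesis by (simp add: filterlim_at_top)
  qed
  \<comment> \<open>The factor 1 keeps \<open>S\<close> inside the node set; the factor
    \<open>\<epsilon>\<close> makes its removal harmless for the balance.\<close>
  have ev3: "eventually (\<lambda>n. real n powr (1 - \<epsilon>) \<le> min 1 \<epsilon> * real n) sequentially"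
  proof -
    have "(\<lambda>n. real n powr (- \<epsilon>)) \<longlonglongrightarrow> 0" using \<epsilon> by real_asymp
    then have "eventually (\<lambda>n. real n powr (- \<epsilon>) < min 1 \<epsilon>) sequentially"
      by (rule order_tendstoD) (use \<epsilon> in auto)
    then show ?thesis using eventually_gt_at_top[of 0]
    proof eventually_elim
      case (elim n)
      have "real n powr (1 - \<epsilon>) = real n powr (- \<epsilon>) * real n"
        using elim by (simp add: powr_diff powr_minus field_simps)
      also have "\<dots> \<le> min 1 \<epsilon> * real n" using elim by (intro mult_right_mono) auto
      finally show ?case .
    qed
  qed
  have ev4: "eventually (\<lambda>n. real n powr (1 - \<epsilon>) \<ge> 2) sequentially"
  proof -
    have "filterlim (\<lambda>n. real n powr (1 - \<epsilon>)) at_top sequentially" using \<epsilon>1 by real_asymp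
    then show ?thesis by (simp add: filterlim_at_top)
  qed
  have le: "eventually (\<lambda>n. measure_pmf.prob (censored_hsbm m n p q (a n)) {(\<sigma>, A). est n A = \<sigma>} \<le> bd n) sequentially"
    using ev1 ev2 ev3 ev4 eventually_ge_at_top[of 2]
  proof eventually_elim
    case (elim n)
    define S where "S = {1..s n}"
    define B where "B = {\<sigma> \<in> labelings n. \<bar>\<Sum>j\<in>{1..n}. real_of_int (\<sigma> j)\<bar> < \<epsilon> * real n}"
    have n: "real n \<ge> 2" using elim by simp
    have ln: "ln (real n) > 0" using n by simp
    have "real n ^ 1 \<le> real n ^ (m - 1)" using m n by (intro power_increasing) auto
    then have "a n \<le> t * ln (real n) / real n"
      unfolding a_def using t ln n by (intro divide_left_mono) auto
    moreover have "t * ln (real n) / real n \<le> 1 / 2" "t * ln (real n) / real n \<le> \<epsilon> / 2"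
      using elim(1) unfolding min.bounded_iff by blast+
    ultimately have a: "a n \<le> 1 / 2" "2 * a n \<le> \<epsilon>" by linarith+
    have a0: "0 \<le> a n" using t ln by (simp add: a_def)
    have s_le: "real (s n) \<le> real n powr (1 - \<epsilon>)" by (simp add: s_def)
    \<comment> \<open>Rounding down loses at most 1, which is at most half of a value that is at
      least 2.\<close>
    have s_ge: "real (s n) \<ge> real n powr (1 - \<epsilon>) / 2"
    proof -
      have "real (s n) \<ge> real n powr (1 - \<epsilon>) - 1" by (simp add: s_def)
      then show ?thesis using elim(4) by simp
    qed
    have "real n powr (1 - \<epsilon>) \<le> 1 * real n" "real n powr (1 - \<epsilon>) \<le> \<epsilon> * real n"
      by (rule order_trans[OF elim(3)], rule mult_right_mono, simp, simp)+
    then have s_n: "s n \<le> n" "real (s n) \<le> \<epsilon> * real n" using s_le by auto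
    have s1: "s n \<ge> 1" using s_ge elim(4) by linarith
    have S: "S \<subseteq> {1..n}" "S \<noteq> {}" "card S = s n" using s_n s1 by (auto simp: S_def)
    have g: "g n > 0" using n by (simp add: g_def)
    have main: "measure_pmf.prob (censored_hsbm m n p q (a n)) {(\<sigma>, A). est n A = \<sigma>} \<le>
       real (card (labelings n - B)) / 2 ^ n + 6 / (real (card S) * g n) +
       8 * (a n * (real (card S) * real n ^ (m - 2)))"
    proof (rule success_prob_le[OF _ p q m S(1,2) g])
      show "B \<subseteq> labelings n" by (auto simp: B_def)
      show "g n \<le> measure_pmf.prob (obs_law m n p q (a n) \<sigma>)
        {A. (\<Prod>e | e \<in> nsets {1..n} m \<and> e \<inter> S = {i}. pmf (edge_law (a n) (edge_prob n p q \<sigma> e)) (A e)) \<le>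
            (\<Prod>e | e \<in> nsets {1..n} m \<and> e \<inter> S = {i}. pmf (edge_law (a n) (edge_prob n p q (flip i \<sigma>) e)) (A e))}"
        if "\<sigma> \<in> B" "i \<in> S" for \<sigma> i
        unfolding g_def \<tau>_def h_def a_def
      proof (rule flip_prob_ge_powr[OF p q m t \<epsilon> _ S(1) that(2) elim(5) _ _ _ _ elim(2)])
        show "\<sigma> \<in> labelings n" "\<bar>\<Sum>j\<in>{1..n}. real_of_int (\<sigma> j)\<bar> < \<epsilon> * real n"
          using that(1) by (simp_all add: B_def)
        show "real (card S) \<le> \<epsilon> * real n" using s_n S(3) by simp
        show "t * ln (real n) / real n ^ (m - 1) \<le> 1 / 2" "2 * (t * ln (real n) / real n ^ (m - 1)) \<le> \<epsilon>"
          using a by (simp_all only: a_def)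
      qed
    qed (use a a0 in auto)
    have compl: "labelings n - B = {\<sigma> \<in> labelings n. \<epsilon> * real n \<le> \<bar>\<Sum>j\<in>{1..n}. real_of_int (\<sigma> j)\<bar>}"
      by (auto simp: B_def)
    have b1: "real (card (labelings n - B)) / 2 ^ n \<le> 1 / (\<epsilon>\<^sup>2 * real n)"
      unfolding compl using n \<epsilon> by (intro unbalanced_labelings_le) auto
    \<comment> \<open>The 8 is 2 from rounding in \<open>s_ge\<close> times 4 from
      \<open>g\<close>.\<close>
    have b2: "6 / (real (card S) * g n) \<le> 6 / (real n powr \<theta> / 8)"
    proof (rule divide_left_mono)
      have "real n powr \<theta> / 8 = (real n powr (1 - \<epsilon>) / 2) * g n"
        unfolding \<theta>_eq[symmetric] powr_add g_def by simp
      also have "\<dots> \<le> real (card S) * g n"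
        unfolding S(3) using g by (intro mult_right_mono s_ge) auto
      finally show "real n powr \<theta> / 8 \<le> real (card S) * g n" .
    qed (use S s1 g n in auto)
    \<comment> \<open>The powers of \<open>n\<close> in \<open>a n\<close> cancel against
      \<open>real n * real n ^ (m - 2)\<close>, and the missing factor
      \<open>n powr \<epsilon>\<close> in the size of \<open>S\<close> beats the logarithm.\<close>
    have b3: "a n * (real (card S) * real n ^ (m - 2)) \<le> t * ln (real n) * real n powr (- \<epsilon>)"
    proof -
      have "a n * (real (card S) * real n ^ (m - 2)) \<le> a n * (real n powr (1 - \<epsilon>) * real n ^ (m - 2))"
        unfolding S(3) using a0 s_le by (intro mult_left_mono mult_right_mono) auto
      also have "\<dots> = real n powr (- \<epsilon>) * (a n * (real n * real n ^ (m - 2)))"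
      proof -
        have "real n powr (1 - \<epsilon>) = real n powr (- \<epsilon>) * real n"
          using powr_add[of "real n" "- \<epsilon>" 1] n by simp
        then show ?thesis by (simp only: mult_ac)
      qed
      also have "real n * real n ^ (m - 2) = real n ^ (m - 1)"
      proof -
        have "m - 1 = Suc (m - 2)" using m by linarith
        then show ?thesis by (simp only: power_Suc)
      qed
      also have "a n * real n ^ (m - 1) = t * ln (real n)" using n by (simp add: a_def)
      finally show ?thesis by (simp only: mult.commute)
    qed
    show ?case unfolding bd_def
      by (rule order_trans[OF main], intro add_mono b1 b2 mult_left_mono b3) simp
  qed
  have bd: "bd \<longlonglongrightarrow> 0"
  proof -
    have "(\<lambda>n. 1 / \<epsilon>\<^sup>2 * (1 / real n)) \<longlonglongrightarrow> 1 / \<epsilon>\<^sup>2 * 0"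
      by (intro tendsto_mult tendsto_const lim_1_over_n)
    moreover have "(\<lambda>n. 48 * real n powr (- \<theta>)) \<longlonglongrightarrow> 48 * 0"
      using \<theta> by (intro tendsto_mult tendsto_const tendsto_neg_powr filterlim_real_sequentially) auto
    moreover have "(\<lambda>n. 8 * t * (ln (real n) / real n powr \<epsilon>)) \<longlonglongrightarrow> 8 * t * 0"
      using \<epsilon> by (intro tendsto_mult tendsto_const lim_ln_over_power)
    ultimately have "(\<lambda>n. 1 / \<epsilon>\<^sup>2 * (1 / real n) + 48 * real n powr (- \<theta>) +
        8 * t * (ln (real n) / real n powr \<epsilon>)) \<longlonglongrightarrow> 1 / \<epsilon>\<^sup>2 * 0 + 48 * 0 + 8 * t * 0"
      by (intro tendsto_add)
    moreover have "bd = (\<lambda>n. 1 / \<epsilon>\<^sup>2 * (1 / real n) + 48 * real n powr (- \<theta>) +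
        8 * t * (ln (real n) / real n powr \<epsilon>))"
      by (simp add: bd_def fun_eq_iff powr_minus_divide)
    ultimately show ?thesis by (simp only: mult_zero_right add_0)
  qed
  have "(\<lambda>n. measure_pmf.prob (censored_hsbm m n p q (a n)) {(\<sigma>, A). est n A = \<sigma>}) \<longlonglongrightarrow> 0"
    by (rule tendsto_sandwich[OF _ le tendsto_const bd]) (rule always_eventually, intro allI measure_nonneg)
  then show ?thesis unfolding a_def .
qed

end
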